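(* Let $\mathbb F$ be a field. Let $D$ be a finite-dimensional graded-division algebra over $\mathbb F$ with $1$-dimensional homogeneous components and let $\varphi_0$ be a degree-preserving involution on $D$ such that $(D,\varphi_0)$ is central simple as an algebra with involution. Let $\delta\in\{\pm1\}$ and let $\underline d=(d_1,d_2)$ where $d_i\in D^\times_{\mathrm{gr}}$ satisfy $\varphi_0(d_i)=\delta d_i$ for $i=1,2$. Then the grading $\Gamma_{\mathcal M}(D,\varphi_0,2,0,\underline d,\delta)$ is fine (as a grading on an algebra with involution) if and only if $\deg d_1\ne\deg d_2$.
   Context: All algebras are associative; all grading groups are abelian; the ground field $\mathbb F$ is arbitrary. An involution is an $\mathbb F$-linear antiautomorphism whose square is the identity; degree-preserving means each homogeneous component is mapped to itself. A grading on an algebra with involution is a grading on the algebra for which the involution is degree-preserving. A graded-division algebra is a unital graded algebra in which all nonzero homogeneous elements are invertible; $D^\times_{\mathrm{gr}}$ is the group of its nonzero homogeneous elements; "$1$-dimensional homogeneous components" means each nonzero component has dimension 1 over $\mathbb F$. $(D,\varphi_0)$ is central simple as an algebra with involution if it has no proper nonzero $\varphi_0$-invariant two-sided ideals and the $\varphi_0$-symmetric elements of the center of $D$ are exactly the scalars $\mathbb F$. A grading $A=\bigoplus_gA_g$ is a refinement of $A=\bigoplus_hA'_h$ if every $A_g$ is contained in some $A'_h$, proper if some inclusion (with $A_g\ne0$) is proper; a grading on an algebra with involution is fine if it has no proper refinement among gradings on that algebra with involution. Let $T$ be the support of $D$ (an abelian group) and $t_i=\deg d_i$. $\widetilde G(T,2,0,(t_1,t_2))$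 is the abelian group generated by $T$ and $\tilde g_1,\tilde g_2$ (the quotient of the direct product of $T$ and the free abelian group on $\tilde g_1,\tilde g_2$) by the relation $\tilde g_1^2t_1^{-1}=\tilde g_2^2t_2^{-1}$; $T$ embeds in it. $\Gamma_{\mathcal M}(D,\varphi_0,2,0,\underline d,\delta)$ is the grading by this group on $M_2(D)=M_2(\mathbb F)\otimes D$ given by $\deg(E_{ij}\otimes d)=\tilde g_i\tilde g_j^{-1}t$ for $0\ne d\in D_t$, where $E_{ij}$ are the matrix units, considered on the algebra with involution $(M_2(D),\varphi)$ where $\varphi(X)=\Phi^{-1}\varphi_0(X^T)\Phi$ ($X^T$ is the transpose and $\varphi_0$ is applied entrywise) and $\Phi=\mathrm{diag}(d_1,d_2)$.
   Formalization: The field is assumed to have characteristic different from 2: in characteristic 2 the hypotheses force D = F, so deg d_1 = deg d_2 always, while the grading is always fine (e.g. M_2(F_2) with transpose), and the claimed equivalence fails. *)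

theory Defs
  imports "HOL-Analysis.Analysis" "HOL-Algebra.Free_Abelian_Groups" "HOL-Library.Z2"
begin

section \<open>Algebras with involution over a field\<close>

locale unital_algebra = vector_space smul
  for smul :: "'f::field \<Rightarrow> 'a::ab_group_add \<Rightarrow> 'a" +
  fixes mul :: "'a \<Rightarrow> 'a \<Rightarrow> 'a" (infixl "\<star>" 70)
    and unit :: 'a
  assumes mul_assoc: "(x \<star> y) \<star> z = x \<star> (y \<star> z)"
    and mul_add_left: "(x + y) \<star> z = x \<star> z + y \<star> z"
    and mul_add_right: "x \<star> (y + z) = x \<star> y + x \<star> z"
    and mul_scale_left: "smul c x \<star> y = smul c (x \<star> y)"
    and mul_scale_right: "x \<star> smul c y = smul c (x \<star> y)"
    and unit_left: "unit \<star> x = x"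
    and unit_right: "x \<star> unit = x"
begin

definition finite_dim :: bool where
  "finite_dim \<longleftrightarrow> (\<exists>B. finite B \<and> span B = UNIV)"

definition two_sided_ideal :: "'a set \<Rightarrow> bool" where
  "two_sided_ideal I \<longleftrightarrow> subspace I \<and> (\<forall>a. \<forall>x\<in>I. a \<star> x \<in> I \<and> x \<star> a \<in> I)"

definition center :: "'a set" where
  "center = {z. \<forall>x. z \<star> x = x \<star> z}"

text \<open>Only the values of \<open>\<Gamma>\<close> on the carrier of the grading group matter.\<close>

definition is_grading :: "('g, 'z) monoid_scheme \<Rightarrow> ('g \<Rightarrow> 'a set) \<Rightarrow> bool" where
  "is_grading G \<Gamma> \<longleftrightarrow>
     comm_group G \<and>
     (\<forall>g\<in>carrier G. subspace (\<Gamma> g)) \<and>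
     (\<forall>a. \<exists>!f. (\<forall>g\<in>carrier G. f g \<in> \<Gamma> g) \<and> (\<forall>g. g \<notin> carrier G \<longrightarrow> f g = 0) \<and>
               finite {g. f g \<noteq> 0} \<and> a = (\<Sum>g | f g \<noteq> 0. f g)) \<and>
     (\<forall>g\<in>carrier G. \<forall>h\<in>carrier G. \<forall>x\<in>\<Gamma> g. \<forall>y\<in>\<Gamma> h. x \<star> y \<in> \<Gamma> (g \<otimes>\<^bsub>G\<^esub> h))"

end

definition grading_support :: "('g, 'z) monoid_scheme \<Rightarrow> ('g \<Rightarrow> 'a::zero set) \<Rightarrow> 'g set" where
  "grading_support G \<Gamma> = {g \<in> carrier G. \<Gamma> g \<noteq> {0}}"

definition nonzero_homogeneous :: "('g, 'z) monoid_scheme \<Rightarrow> ('g \<Rightarrow> 'a::zero set) \<Rightarrow> 'a set" where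
  "nonzero_homogeneous G \<Gamma> = (\<Union>g\<in>carrier G. \<Gamma> g) - {0}"

definition hom_degree :: "('g, 'z) monoid_scheme \<Rightarrow> ('g \<Rightarrow> 'a set) \<Rightarrow> 'a \<Rightarrow> 'g" where
  "hom_degree G \<Gamma> x = (THE g. g \<in> carrier G \<and> x \<in> \<Gamma> g)"

context unital_algebra
begin

definition is_division_grading :: "('g, 'z) monoid_scheme \<Rightarrow> ('g \<Rightarrow> 'a set) \<Rightarrow> bool" where
  "is_division_grading G \<Gamma> \<longleftrightarrow>
     is_grading G \<Gamma> \<and>
     (\<forall>x\<in>nonzero_homogeneous G \<Gamma>. \<exists>y. x \<star> y = unit \<and> y \<star> x = unit)"

definition one_dim_components :: "('g, 'z) monoid_scheme \<Rightarrow> ('g \<Rightarrow> 'a set) \<Rightarrow> bool" where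
  "one_dim_components G \<Gamma> \<longleftrightarrow> (\<forall>g\<in>grading_support G \<Gamma>. dim (\<Gamma> g) = 1)"

end

locale involution_algebra = unital_algebra smul mul unit
  for smul :: "'f::field \<Rightarrow> 'a::ab_group_add \<Rightarrow> 'a"
    and mul :: "'a \<Rightarrow> 'a \<Rightarrow> 'a" (infixl "\<star>" 70)
    and unit :: 'a +
  fixes \<sigma> :: "'a \<Rightarrow> 'a"
  assumes inv_add: "\<sigma> (x + y) = \<sigma> x + \<sigma> y"
    and inv_scale: "\<sigma> (smul c x) = smul c (\<sigma> x)"
    and inv_mul: "\<sigma> (x \<star> y) = \<sigma> y \<star> \<sigma> x"
    and inv_inv: "\<sigma> (\<sigma> x) = x"
begin

definition central_simple :: bool where
  "central_simple \<longleftrightarrow>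
     (\<forall>I. two_sided_ideal I \<and> \<sigma> ` I \<subseteq> I \<longrightarrow> I = {0} \<or> I = UNIV) \<and>
     {z \<in> center. \<sigma> z = z} = range (\<lambda>c. smul c unit)"

definition is_inv_grading :: "('g, 'z) monoid_scheme \<Rightarrow> ('g \<Rightarrow> 'a set) \<Rightarrow> bool" where
  "is_inv_grading G \<Gamma> \<longleftrightarrow> is_grading G \<Gamma> \<and> (\<forall>g\<in>carrier G. \<sigma> ` \<Gamma> g \<subseteq> \<Gamma> g)"

end

definition is_refinement ::
    "('h, 'y) monoid_scheme \<Rightarrow> ('h \<Rightarrow> 'a set) \<Rightarrow> ('g, 'z) monoid_scheme \<Rightarrow> ('g \<Rightarrow> 'a set) \<Rightarrow> bool" where
  "is_refinement H \<Delta> G \<Gamma> \<longleftrightarrow> (\<forall>h\<in>carrier H. \<exists>g\<in>carrier G. \<Delta> h \<subseteq> \<Gamma> g)"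

definition is_proper_refinement ::
    "('h, 'y) monoid_scheme \<Rightarrow> ('h \<Rightarrow> 'a::zero set) \<Rightarrow> ('g, 'z) monoid_scheme \<Rightarrow> ('g \<Rightarrow> 'a set) \<Rightarrow> bool" where
  "is_proper_refinement H \<Delta> G \<Gamma> \<longleftrightarrow>
     is_refinement H \<Delta> G \<Gamma> \<and>
     (\<exists>h\<in>carrier H. \<exists>g\<in>carrier G. \<Delta> h \<noteq> {0} \<and> \<Delta> h \<subset> \<Gamma> g)"

context involution_algebra
begin

text \<open>
  A formula cannot quantify over the type of the elements of the group \<open>H\<close>. On a
  finite-dimensional algebra, groups with elements of type \<^typ>\<open>nat\<close> suffice: a grading has finite
  support and the subgroup generated by the support is countable. The lemma
  \<open>fine_imp_no_proper_refinement\<close> below proves this for grading groups of arbitrary type.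
\<close>

definition is_fine :: "('g, 'z) monoid_scheme \<Rightarrow> ('g \<Rightarrow> 'a set) \<Rightarrow> bool" where
  "is_fine G \<Gamma> \<longleftrightarrow>
     is_inv_grading G \<Gamma> \<and>
     \<not> (\<exists>(H :: nat monoid) \<Delta>. is_inv_grading H \<Delta> \<and> is_proper_refinement H \<Delta> G \<Gamma>)"

end


section \<open>The group \<open>\<tilde>G(T,2,0,(t\<^sub>1,t\<^sub>2))\<close>\<close>

text \<open>
  The index set \<open>{1,2}\<close> is the type \<^typ>\<open>2\<close>, so \<open>t 1\<close> and \<open>t 2\<close> are \<open>t\<^sub>1\<close> and \<open>t\<^sub>2\<close>.
  Elements of the quotient are cosets.
\<close>

abbreviation tilde_base :: "('g, 'z) monoid_scheme \<Rightarrow> ('g \<times> (2 \<Rightarrow>\<^sub>0 int)) monoid" where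
  "tilde_base T \<equiv> T \<times>\<times> free_Abelian_group (UNIV :: 2 set)"

definition tilde_side :: "('g, 'z) monoid_scheme \<Rightarrow> (2 \<Rightarrow> 'g) \<Rightarrow> 2 \<Rightarrow> 'g \<times> (2 \<Rightarrow>\<^sub>0 int)" where
  "tilde_side T t i =
     (\<one>\<^bsub>T\<^esub>, frag_of i) [^]\<^bsub>tilde_base T\<^esub> (2::nat) \<otimes>\<^bsub>tilde_base T\<^esub> inv\<^bsub>tilde_base T\<^esub> (t i, 0)"

definition tilde_relations :: "('g, 'z) monoid_scheme \<Rightarrow> (2 \<Rightarrow> 'g) \<Rightarrow> ('g \<times> (2 \<Rightarrow>\<^sub>0 int)) set" where
  "tilde_relations T t =
     generate (tilde_base T)
       {tilde_side T t 1 \<otimes>\<^bsub>tilde_base T\<^esub> inv\<^bsub>tilde_base T\<^esub> tilde_side T t 2}"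

definition tilde_group :: "('g, 'z) monoid_scheme \<Rightarrow> (2 \<Rightarrow> 'g) \<Rightarrow> ('g \<times> (2 \<Rightarrow>\<^sub>0 int)) set monoid" where
  "tilde_group T t = tilde_base T Mod tilde_relations T t"

definition tilde_gen :: "('g, 'z) monoid_scheme \<Rightarrow> (2 \<Rightarrow> 'g) \<Rightarrow> 2 \<Rightarrow> ('g \<times> (2 \<Rightarrow>\<^sub>0 int)) set" where
  "tilde_gen T t i = tilde_relations T t #>\<^bsub>tilde_base T\<^esub> (\<one>\<^bsub>T\<^esub>, frag_of i)"

definition tilde_emb :: "('g, 'z) monoid_scheme \<Rightarrow> (2 \<Rightarrow> 'g) \<Rightarrow> 'g \<Rightarrow> ('g \<times> (2 \<Rightarrow>\<^sub>0 int)) set" where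
  "tilde_emb T t s = tilde_relations T t #>\<^bsub>tilde_base T\<^esub> (s, 0)"


section \<open>The graded algebra with involution \<open>M\<^sub>2(D)\<close>\<close>

definition m2_scale :: "('f \<Rightarrow> 'd \<Rightarrow> 'd) \<Rightarrow> 'f \<Rightarrow> 'd^2^2 \<Rightarrow> 'd^2^2" where
  "m2_scale smul c X = (\<chi> i j. smul c (X $ i $ j))"

text \<open>\<open>E\<^sub>i\<^sub>j \<otimes> x\<close>\<close>

definition m2_elem :: "2 \<Rightarrow> 2 \<Rightarrow> 'd::zero \<Rightarrow> 'd^2^2" where
  "m2_elem i j x = (\<chi> k l. if k = i \<and> l = j then x else 0)"

definition m2_diag :: "'d::zero^2 \<Rightarrow> 'd^2^2" where
  "m2_diag d = (\<chi> i j. if i = j then d $ i else 0)"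

definition m2_involution :: "('d::ring_1 \<Rightarrow> 'd) \<Rightarrow> 'd^2 \<Rightarrow> 'd^2^2 \<Rightarrow> 'd^2^2" where
  "m2_involution \<phi>\<^sub>0 d X =
     matrix_inv (m2_diag d) ** (\<chi> i j. \<phi>\<^sub>0 (transpose X $ i $ j)) ** m2_diag d"

text \<open>
  In the next two definitions \<open>D\<close> is graded by \<open>\<Gamma>\<close> over \<open>G\<close>, and \<open>T\<close> is the support of \<open>\<Gamma>\<close>
  as a subgroup of \<open>G\<close>.
\<close>

definition m2_group ::
    "('g, 'z) monoid_scheme \<Rightarrow> ('g \<Rightarrow> 'd::zero set) \<Rightarrow> 'd^2 \<Rightarrow> ('g \<times> (2 \<Rightarrow>\<^sub>0 int)) set monoid" where
  "m2_group G \<Gamma> d =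
     tilde_group (G\<lparr>carrier := grading_support G \<Gamma>\<rparr>) (\<lambda>i. hom_degree G \<Gamma> (d $ i))"

definition m2_grading ::
    "('f::field \<Rightarrow> 'd::ring_1 \<Rightarrow> 'd) \<Rightarrow> ('g, 'z) monoid_scheme \<Rightarrow> ('g \<Rightarrow> 'd set) \<Rightarrow> 'd^2 \<Rightarrow>
     ('g \<times> (2 \<Rightarrow>\<^sub>0 int)) set \<Rightarrow> ('d^2^2) set" where
  "m2_grading smul G \<Gamma> d \<gamma> =
     (let T = G\<lparr>carrier := grading_support G \<Gamma>\<rparr>;
          t = (\<lambda>i. hom_degree G \<Gamma> (d $ i));
          K = tilde_group T t
      in module.span (m2_scale smul)
           {m2_elem i j x | i j s x. s \<in> carrier T \<and> x \<in> \<Gamma> s \<and>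
              tilde_gen T t i \<otimes>\<^bsub>K\<^esub> inv\<^bsub>K\<^esub> tilde_gen T t j \<otimes>\<^bsub>K\<^esub> tilde_emb T t s = \<gamma>})"


section \<open>Grading groups of arbitrary type\<close>

context unital_algebra
begin

definition is_decomposition ::
    "('g, 'z) monoid_scheme \<Rightarrow> ('g \<Rightarrow> 'a set) \<Rightarrow> 'a \<Rightarrow> ('g \<Rightarrow> 'a) \<Rightarrow> bool" where
  "is_decomposition G \<Gamma> a f \<longleftrightarrow>
     (\<forall>g\<in>carrier G. f g \<in> \<Gamma> g) \<and> (\<forall>g. g \<notin> carrier G \<longrightarrow> f g = 0) \<and>
     finite {g. f g \<noteq> 0} \<and> a = (\<Sum>g | f g \<noteq> 0. f g)"

lemma decomposition_unique:
  assumes "is_grading G \<Gamma>" "is_decomposition G \<Gamma> a f" "is_decomposition G \<Gamma> a f'"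
  shows "f = f'"
proof -
  have "\<exists>!f. is_decomposition G \<Gamma> a f"
    using assms(1) unfolding is_grading_def is_decomposition_def[symmetric] by simp
  then show ?thesis using assms(2,3) by (elim ex1E) metis
qed

lemma decomposition_exists:
  assumes "is_grading G \<Gamma>"
  obtains f where "is_decomposition G \<Gamma> a f"
proof -
  have "\<exists>!f. is_decomposition G \<Gamma> a f"
    using assms unfolding is_grading_def is_decomposition_def[symmetric] by simp
  then show ?thesis using that by (elim ex1E) metis
qed

lemma decompositionI:
  assumes "is_grading G \<Gamma>" "finite S" "S \<subseteq> carrier G" "\<And>g. g \<in> S \<Longrightarrow> f g \<in> \<Gamma> g"
  shows "is_decomposition G \<Gamma> (\<Sum>g\<in>S. f g) (\<lambda>g. if g \<in> S then f g else 0)"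
proof -
  have "\<And>g. g \<in> carrier G \<Longrightarrow> 0 \<in> \<Gamma> g"
    using assms(1) by (auto simp: is_grading_def intro: subspace_0)
  moreover have "(\<Sum>g | (if g \<in> S then f g else 0) \<noteq> 0. if g \<in> S then f g else 0) = (\<Sum>g\<in>S. f g)"
    by (rule sum.mono_neutral_cong_left) (use assms in \<open>auto split: if_splits\<close>)
  moreover have "finite {g. (if g \<in> S then f g else 0) \<noteq> 0}"
    by (rule finite_subset[OF _ assms(2)]) auto
  ultimately show ?thesis
    using assms unfolding is_decomposition_def by auto
qed

lemma component_disjoint:
  assumes "is_grading G \<Gamma>" "g \<in> carrier G" "h \<in> carrier G" "x \<in> \<Gamma> g" "x \<in> \<Gamma> h" "x \<noteq> 0"
  shows "g = h"
proof -
  have "is_decomposition G \<Gamma> x (\<lambda>k. if k \<in> {g} then x else 0)"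
    using decompositionI[of G \<Gamma> "{g}" "\<lambda>_. x"] assms by simp
  moreover have "is_decomposition G \<Gamma> x (\<lambda>k. if k \<in> {h} then x else 0)"
    using decompositionI[of G \<Gamma> "{h}" "\<lambda>_. x"] assms by simp
  ultimately have "(\<lambda>k. if k \<in> {g} then x else 0) = (\<lambda>k. if k \<in> {h} then x else 0)"
    by (rule decomposition_unique[OF assms(1)])
  from fun_cong[OF this, of g] show ?thesis using assms(6) by (auto split: if_splits)
qed

lemma finite_support:
  assumes fd: finite_dim and gr: "is_grading G \<Gamma>"
  shows "finite (grading_support G \<Gamma>)"
proof -
  obtain B where B: "finite B" "span B = UNIV" using fd by (auto simp: finite_dim_def)
  have "\<forall>b. \<exists>f. is_decomposition G \<Gamma> b f" using decomposition_exists[OF gr] by metis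
  then obtain F where F: "\<And>b. is_decomposition G \<Gamma> b (F b)" by metis
  define S where "S = (\<Union>b\<in>B. {g. F b g \<noteq> 0})"
  have fS: "finite S" using B F by (auto simp: S_def is_decomposition_def)
  have SG: "S \<subseteq> carrier G" using F by (auto simp: S_def is_decomposition_def)
  have sub: "\<And>g. g \<in> carrier G \<Longrightarrow> subspace (\<Gamma> g)" using gr by (auto simp: is_grading_def)
  define W where "W = {\<Sum>g\<in>S. y g | y. \<forall>g\<in>S. y g \<in> \<Gamma> g}"
  have "subspace W"
    unfolding subspace_def
  proof (intro conjI ballI allI)
    show "0 \<in> W" unfolding W_def using SG sub
      by (auto intro!: exI[of _ "\<lambda>_. 0"] subspace_0)
  next
    fix x y assume "x \<in> W" "y \<in> W"
    then obtain u v where "x = (\<Sum>g\<in>S. u g)" "y = (\<Sum>g\<in>S. v g)" "\<forall>g\<in>S. u g \<in> \<Gamma> g" "\<forall>g\<in>S. v g \<in> \<Gamma> g"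
      unfolding W_def by auto
    then show "x + y \<in> W" unfolding W_def using SG sub
      by (auto intro!: exI[of _ "\<lambda>g. u g + v g"] simp: sum.distrib subspace_add subset_iff)
  next
    fix c x assume "x \<in> W"
    then obtain u where "x = (\<Sum>g\<in>S. u g)" "\<forall>g\<in>S. u g \<in> \<Gamma> g"
      unfolding W_def by auto
    then show "smul c x \<in> W" unfolding W_def using SG sub
      by (auto intro!: exI[of _ "\<lambda>g. smul c (u g)"] simp: scale_sum_right subspace_scale subset_iff)
  qed
  moreover have "B \<subseteq> W"
  proof
    fix b assume b: "b \<in> B"
    have "b = (\<Sum>g | F b g \<noteq> 0. F b g)" using F by (auto simp: is_decomposition_def)
    also have "\<dots> = (\<Sum>g\<in>S. F b g)"
      by (rule sum.mono_neutral_left) (use fS b in \<open>auto simp: S_def\<close>)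
    finally show "b \<in> W" unfolding W_def using F SG
      by (auto simp: is_decomposition_def subset_iff intro!: exI[of _ "F b"])
  qed
  ultimately have W: "W = UNIV" using B(2) span_minimal by blast
  have "grading_support G \<Gamma> \<subseteq> S"
  proof
    fix h assume "h \<in> grading_support G \<Gamma>"
    then have h: "h \<in> carrier G" "\<Gamma> h \<noteq> {0}" by (auto simp: grading_support_def)
    then obtain x where x: "x \<in> \<Gamma> h" "x \<noteq> 0" using subspace_0[OF sub[OF h(1)]] by auto
    from W have "x \<in> W" by simp
    then obtain y where y: "x = (\<Sum>g\<in>S. y g)" "\<And>g. g \<in> S \<Longrightarrow> y g \<in> \<Gamma> g" unfolding W_def by auto
    have "is_decomposition G \<Gamma> x (\<lambda>g. if g \<in> S then y g else 0)"
      using decompositionI[OF gr fS SG, of y] y by auto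
    moreover have "is_decomposition G \<Gamma> x (\<lambda>g. if g \<in> {h} then x else 0)"
      using decompositionI[OF gr, of "{h}" "\<lambda>_. x"] x h by simp
    ultimately have "(\<lambda>g. if g \<in> S then y g else 0) = (\<lambda>g. if g \<in> {h} then x else 0)"
      by (rule decomposition_unique[OF gr])
    from fun_cong[OF this, of h] x show "h \<in> S" by (auto split: if_splits)
  qed
  then show ?thesis using fS finite_subset by blast
qed

end

lemma (in group) countable_generate:
  assumes "S \<subseteq> carrier G" "countable S"
  shows "countable (generate G S)"
proof -
  let ?L = "lists (S \<union> m_inv G ` S)"
  let ?p = "\<lambda>xs. foldr (\<otimes>) xs \<one>"
  have cl: "?p xs \<in> carrier G" if "xs \<in> ?L" for xs
    using that assms(1) by (induction xs) auto
  have app: "?p xs \<otimes> ?p ys = ?p (xs @ ys)" if "xs \<in> ?L" "ys \<in> ?L" for xs ys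
    using that(1)
  proof (induction xs)
    case Nil then show ?case using cl[OF that(2)] by simp
  next
    case (Cons a l)
    then have "a \<in> carrier G" using assms(1) by auto
    with Cons show ?case using cl[OF \<open>l \<in> ?L\<close>] cl[OF that(2)] by (simp add: m_assoc)
  qed
  have "\<exists>xs\<in>?L. ?p xs = x" if "x \<in> generate G S" for x
    using that
  proof induction
    case one
    then show ?case by (intro bexI[of _ "[]"]) simp_all
  next
    case (incl h)
    then show ?case using assms(1) by (intro bexI[of _ "[h]"]) auto
  next
    case (inv h)
    then show ?case using assms(1) by (intro bexI[of _ "[inv h]"]) auto
  next
    case (eng h1 h2)
    then obtain xs ys where "xs \<in> ?L" "ys \<in> ?L" "?p xs = h1" "?p ys = h2" by blast
    then show ?case using app[of xs ys] by (intro bexI[of _ "xs @ ys"]) simp_all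
  qed
  then have "generate G S \<subseteq> ?p ` ?L" by blast
  moreover have "countable ?L" using assms(2) by (intro countable_lists) auto
  ultimately show ?thesis by (rule countable_subset[OF _ countable_image])
qed

context involution_algebra
begin

lemma fine_imp_no_proper_refinement:
  fixes H :: "('h, 'y) monoid_scheme"
  assumes fd: finite_dim and fine: "is_fine G \<Gamma>" and inv_gr: "is_inv_grading H \<Delta>"
  shows "\<not> is_proper_refinement H \<Delta> G \<Gamma>"
proof
  assume ref: "is_proper_refinement H \<Delta> G \<Gamma>"
  have gr: "is_grading H \<Delta>" using inv_gr by (auto simp: is_inv_grading_def)
  interpret H: comm_group H using gr by (auto simp: is_grading_def)
  have suppH: "grading_support H \<Delta> \<subseteq> carrier H" by (auto simp: grading_support_def)
  define K where "K = generate H (grading_support H \<Delta>)"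
  interpret K: subgroup K H unfolding K_def by (rule H.generate_is_subgroup[OF suppH])
  have cK: "countable K"
    unfolding K_def by (intro H.countable_generate suppH countable_finite finite_support fd gr)
  have zero: "x = 0" if "x \<in> \<Delta> h" "h \<in> carrier H" "h \<notin> K" for x h
    using that generate.incl[of h "grading_support H \<Delta>" H] by (auto simp: grading_support_def K_def)
  define e where "e = to_nat_on K"
  define r where "r = from_nat_into K"
  have re [simp]: "r (e x) = x" if "x \<in> K" for x
    using that cK by (simp add: e_def r_def)
  have sub: "\<And>g. g \<in> carrier H \<Longrightarrow> subspace (\<Delta> g)" using gr by (auto simp: is_grading_def)
  define N :: "nat monoid" where
    "N = \<lparr>carrier = e ` K, monoid.mult = (\<lambda>m n. e (r m \<otimes>\<^bsub>H\<^esub> r n)), one = e \<one>\<^bsub>H\<^esub>\<rparr>"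
  have Nsimps [simp]: "carrier N = e ` K" "m \<otimes>\<^bsub>N\<^esub> n = e (r m \<otimes>\<^bsub>H\<^esub> r n)" "\<one>\<^bsub>N\<^esub> = e \<one>\<^bsub>H\<^esub>" for m n
    by (auto simp: N_def)
  have N: "comm_group N"
  proof (rule comm_groupI)
    fix x assume "x \<in> carrier N"
    then obtain a where "a \<in> K" "x = e a" by auto
    then show "\<exists>y\<in>carrier N. y \<otimes>\<^bsub>N\<^esub> x = \<one>\<^bsub>N\<^esub>"
      by (auto intro!: bexI[of _ "inv\<^bsub>H\<^esub> a"])
  qed (auto simp: H.m_ac)
  define \<Theta> where "\<Theta> n = \<Delta> (r n)" for n
  have dec1: "is_decomposition N \<Theta> a (\<lambda>n. if n \<in> e ` K then f (r n) else 0)" (is "is_decomposition _ _ _ ?f")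
    if f: "is_decomposition H \<Delta> a f" for a f
  proof -
    have fz: "f g = 0" if "g \<notin> K" for g using f zero[of "f g" g] that by (auto simp: is_decomposition_def)
    have fK: "g \<in> K" if "f g \<noteq> 0" for g using fz that by blast
    have fe: "?f (e g) = f g" if "f g \<noteq> 0" for g using fK[OF that] by simp
    have bij: "bij_betw e {g. f g \<noteq> 0} {n. ?f n \<noteq> 0}"
    proof (rule bij_betwI[where g = r])
      show "e \<in> {g. f g \<noteq> 0} \<rightarrow> {n. ?f n \<noteq> 0}"
      proof (intro funcsetI CollectI)
        fix g assume g: "g \<in> {g. f g \<noteq> 0}"
        then have "g \<in> K" using fz by blast
        then show "?f (e g) \<noteq> 0" using g by simp
      qed
      show "r \<in> {n. ?f n \<noteq> 0} \<rightarrow> {g. f g \<noteq> 0}" by (auto split: if_splits)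
      show "r (e g) = g" if "g \<in> {g. f g \<noteq> 0}" for g using that fz[of g] re[of g] by blast
    qed (auto split: if_splits)
    have "(\<Sum>n | ?f n \<noteq> 0. ?f n) = (\<Sum>g | f g \<noteq> 0. ?f (e g))"
      by (rule sum.reindex_bij_betw[OF bij, symmetric])
    also have "\<dots> = (\<Sum>g | f g \<noteq> 0. f g)" by (rule sum.cong) (simp_all add: fe)
    finally show ?thesis using f bij_betw_finite[OF bij]
      unfolding is_decomposition_def by (auto simp: \<Theta>_def)
  qed
  have dec2: "is_decomposition H \<Delta> a (\<lambda>g. if g \<in> K then f (e g) else 0)" (is "is_decomposition _ _ _ ?f")
    if f: "is_decomposition N \<Theta> a f" for a f
  proof -
    have fK: "\<exists>g\<in>K. n = e g" if "f n \<noteq> 0" for n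
      using f that unfolding is_decomposition_def by auto
    have fr: "?f (r n) = f n" if "f n \<noteq> 0" for n using fK[OF that] by auto
    have bij: "bij_betw r {n. f n \<noteq> 0} {g. ?f g \<noteq> 0}"
    proof (rule bij_betwI[where g = e])
      show "r \<in> {n. f n \<noteq> 0} \<rightarrow> {g. ?f g \<noteq> 0}"
      proof (intro funcsetI CollectI)
        fix n assume n: "n \<in> {n. f n \<noteq> 0}"
        then obtain g where "g \<in> K" "n = e g" using f unfolding is_decomposition_def by auto
        then show "?f (r n) \<noteq> 0" using n by simp
      qed
      show "e \<in> {g. ?f g \<noteq> 0} \<rightarrow> {n. f n \<noteq> 0}" by (auto split: if_splits)
      show "e (r x) = x" if "x \<in> {n. f n \<noteq> 0}" for x
        using that fK[of x] by auto
    qed (auto split: if_splits)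
    have "(\<Sum>n | ?f n \<noteq> 0. ?f n) = (\<Sum>n | f n \<noteq> 0. ?f (r n))"
      by (rule sum.reindex_bij_betw[OF bij, symmetric])
    also have "\<dots> = (\<Sum>n | f n \<noteq> 0. f n)"
      by (rule sum.cong) (simp_all add: fr)
    finally show ?thesis using f bij_betw_finite[OF bij] subspace_0[OF sub] K.subset
      unfolding is_decomposition_def by (auto simp: \<Theta>_def subset_iff)
  qed
  have ex1: "\<exists>!f. is_decomposition N \<Theta> a f" for a
  proof -
    obtain f where f: "is_decomposition H \<Delta> a f" by (rule decomposition_exists[OF gr])
    show ?thesis
    proof (rule ex1I)
      show "is_decomposition N \<Theta> a (\<lambda>n. if n \<in> e ` K then f (r n) else 0)" by (rule dec1[OF f])
      fix f' assume f': "is_decomposition N \<Theta> a f'"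
      have eq: "(\<lambda>g. if g \<in> K then f' (e g) else 0) = f" by (rule decomposition_unique[OF gr dec2[OF f'] f])
      show "f' = (\<lambda>n. if n \<in> e ` K then f (r n) else 0)"
      proof
        fix n show "f' n = (if n \<in> e ` K then f (r n) else 0)"
          unfolding eq[symmetric] using f' by (auto simp: is_decomposition_def)
      qed
    qed
  qed
  have mul: "x \<star> y \<in> \<Delta> (g \<otimes>\<^bsub>H\<^esub> h)" if "g \<in> K" "h \<in> K" "x \<in> \<Delta> g" "y \<in> \<Delta> h" for g h x y
    using gr that K.mem_carrier unfolding is_grading_def by blast
  have "is_grading N \<Theta>"
    unfolding is_grading_def is_decomposition_def[symmetric]
  proof (intro conjI allI ballI)
    show "comm_group N" by (rule N)
    show "\<exists>!f. is_decomposition N \<Theta> a f" for a by (rule ex1)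
    show "subspace (\<Theta> g)" if "g \<in> carrier N" for g
      using that sub K.mem_carrier by (auto simp: \<Theta>_def)
    show "x \<star> y \<in> \<Theta> (g \<otimes>\<^bsub>N\<^esub> h)"
      if "g \<in> carrier N" "h \<in> carrier N" "x \<in> \<Theta> g" "y \<in> \<Theta> h" for g h x y
      using that mul by (auto simp: \<Theta>_def)
  qed
  moreover have "\<forall>g\<in>carrier N. \<sigma> ` \<Theta> g \<subseteq> \<Theta> g"
    using inv_gr K.mem_carrier by (auto simp: \<Theta>_def is_inv_grading_def)
  ultimately have "is_inv_grading N \<Theta>"
    by (simp add: is_inv_grading_def)
  moreover have "is_proper_refinement N \<Theta> G \<Gamma>"
  proof -
    from ref obtain h g where hg: "h \<in> carrier H" "g \<in> carrier G" "\<Delta> h \<noteq> {0}" "\<Delta> h \<subset> \<Gamma> g"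
      by (auto simp: is_proper_refinement_def)
    then have "h \<in> K" using zero[of _ h] subspace_0[OF sub, of h] by blast
    then have "e h \<in> carrier N" "\<Theta> (e h) = \<Delta> h" by (simp_all add: \<Theta>_def)
    moreover have "\<exists>g\<in>carrier G. \<Theta> n \<subseteq> \<Gamma> g" if n: "n \<in> carrier N" for n
    proof -
      obtain k where k: "k \<in> K" "n = e k" using n by auto
      then have "\<exists>g\<in>carrier G. \<Delta> k \<subseteq> \<Gamma> g"
        using ref K.mem_carrier[OF k(1)] unfolding is_proper_refinement_def is_refinement_def by blast
      then show ?thesis using k by (simp add: \<Theta>_def)
    qed
    ultimately show ?thesis using hg unfolding is_proper_refinement_def is_refinement_def by metis
  qed
  ultimately show False using fine unfolding is_fine_def by blast
qed

end

lemma (in unital_algebra) unit_homogeneous: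
  assumes gr: "is_grading G \<Gamma>"
  shows "unit \<in> \<Gamma> \<one>\<^bsub>G\<^esub>"
proof -
  interpret G: comm_group G using gr by (simp add: is_grading_def)
  obtain u where u: "is_decomposition G \<Gamma> unit u" by (rule decomposition_exists[OF gr])
  have uG: "u g \<in> \<Gamma> g" if "g \<in> carrier G" for g using u that by (simp add: is_decomposition_def)
  define S where "S = {g. u g \<noteq> 0}"
  have S: "finite S" "S \<subseteq> carrier G" "unit = (\<Sum>g\<in>S. u g)"
    using u by (auto simp: is_decomposition_def S_def)
  have sum_left: "(\<Sum>g\<in>A. f g) \<star> y = (\<Sum>g\<in>A. f g \<star> y)" if "finite A" for A :: "'b set" and f y
    using that by (induction A) (use mul_scale_left[of 0 0 y] in \<open>auto simp: mul_add_left\<close>)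
  have sum_right: "y \<star> (\<Sum>g\<in>A. f g) = (\<Sum>g\<in>A. y \<star> f g)" if "finite A" for A :: "'b set" and f y
    using that by (induction A) (use mul_scale_right[of y 0 0] in \<open>auto simp: mul_add_right\<close>)
  have zl: "0 \<star> y = 0" for y using mul_scale_left[of 0 0 y] by simp
  have left: "u \<one>\<^bsub>G\<^esub> \<star> y = y" if k: "k \<in> carrier G" and y: "y \<in> \<Gamma> k" for k y
  proof -
    define S' where "S' = (\<lambda>g. g \<otimes>\<^bsub>G\<^esub> k) ` S"
    define f where "f h = u (h \<otimes>\<^bsub>G\<^esub> inv\<^bsub>G\<^esub> k) \<star> y" for h
    have cancel: "g \<otimes>\<^bsub>G\<^esub> k \<otimes>\<^bsub>G\<^esub> inv\<^bsub>G\<^esub> k = g" if "g \<in> carrier G" for g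
      using that k by (simp add: G.m_assoc)
    have inj: "inj_on (\<lambda>g. g \<otimes>\<^bsub>G\<^esub> k) S" using S k by (metis (no_types, lifting) inj_onI cancel subsetD)
    have "(\<Sum>h\<in>S'. f h) = (\<Sum>g\<in>S. f (g \<otimes>\<^bsub>G\<^esub> k))"
      unfolding S'_def using inj by (simp add: sum.reindex)
    also have "\<dots> = (\<Sum>g\<in>S. u g \<star> y)"
      using S by (intro sum.cong) (auto simp: f_def cancel subset_iff)
    also have "\<dots> = unit \<star> y" using S sum_left by metis
    finally have sum: "(\<Sum>h\<in>S'. f h) = y" by (simp add: unit_left)
    have "is_decomposition G \<Gamma> (\<Sum>h\<in>S'. f h) (\<lambda>h. if h \<in> S' then f h else 0)"
    proof (rule decompositionI[OF gr])
      show "finite S'" "S' \<subseteq> carrier G" using S k by (auto simp: S'_def)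
      show "f h \<in> \<Gamma> h" if h: "h \<in> S'" for h
      proof -
        obtain g where g: "g \<in> S" "h = g \<otimes>\<^bsub>G\<^esub> k" using h by (auto simp: S'_def)
        then have "u g \<star> y \<in> \<Gamma> (g \<otimes>\<^bsub>G\<^esub> k)" using gr S uG k y unfolding is_grading_def by blast
        then show ?thesis using g S cancel by (auto simp: f_def)
      qed
    qed
    moreover have "is_decomposition G \<Gamma> y (\<lambda>h. if h \<in> {k} then y else 0)"
      using decompositionI[OF gr, of "{k}" "\<lambda>_. y"] y k by simp
    ultimately have eq: "(\<lambda>h. if h \<in> S' then f h else 0) = (\<lambda>h. if h \<in> {k} then y else 0)"
      unfolding sum by (rule decomposition_unique[OF gr])
    have "k \<in> S'" if "u \<one>\<^bsub>G\<^esub> \<noteq> 0"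
      using that k by (auto simp: S'_def S_def image_iff intro!: exI[of _ "\<one>\<^bsub>G\<^esub>"])
    with fun_cong[OF eq, of k] k show ?thesis
      by (cases "u \<one>\<^bsub>G\<^esub> = 0") (auto simp: f_def zl split: if_splits)
  qed
  have "u \<one>\<^bsub>G\<^esub> = u \<one>\<^bsub>G\<^esub> \<star> unit" by (simp add: unit_right)
  also have "\<dots> = (\<Sum>g\<in>S. u \<one>\<^bsub>G\<^esub> \<star> u g)" using S sum_right by metis
  also have "\<dots> = (\<Sum>g\<in>S. u g)"
    by (rule sum.cong) (use S left uG in auto)
  also have "\<dots> = unit" using S by simp
  finally show ?thesis using uG[of "\<one>\<^bsub>G\<^esub>"] by simp
qed


section \<open>Characteristic 2\<close>

text \<open>
  Over a field of characteristic 2 a grading \<open>\<Gamma>\<^sub>M(D,\<phi>\<^sub>0,2,0,(d\<^sub>1,d\<^sub>2),\<delta>)\<close> can be fine although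
  \<open>deg d\<^sub>1 = deg d\<^sub>2\<close>, so characteristic different from 2 has to be assumed where fineness is
  characterized by \<open>deg d\<^sub>1 \<noteq> deg d\<^sub>2\<close>. The example is \<open>D = F\<close>, the field with two elements
  (type \<^typ>\<open>bit\<close>), graded by the trivial group, with \<open>\<phi>\<^sub>0 = id\<close> and \<open>d\<^sub>1 = d\<^sub>2 = \<delta> = 1\<close>:
  the involution on \<open>M\<^sub>2(F)\<close> is the transpose and the components are the diagonal and
  the antidiagonal matrices. The identity component cannot be split, as it would be \<open>F 1 \<oplus> F e\<close>
  with \<open>e\<close> a diagonal idempotent, whose degree is then trivial; hence the antidiagonal component could
  only split into \<open>F E\<^sub>1\<^sub>2 \<oplus> F E\<^sub>2\<^sub>1\<close>, whose summands are swapped by the transpose.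
\<close>

abbreviation char2_group :: "unit monoid" where
  "char2_group \<equiv> \<lparr>carrier = UNIV, monoid.mult = (\<lambda>_ _. ()), one = ()\<rparr>"

abbreviation char2_grading :: "unit \<Rightarrow> 'f set" where
  "char2_grading \<equiv> \<lambda>_. UNIV"

lemma char2_comm_group: "comm_group char2_group"
  by (rule comm_groupI) auto

lemma char2_involution_algebra: "involution_algebra ((*) :: 'f::field \<Rightarrow> 'f \<Rightarrow> 'f) (*) 1 id"
  by unfold_locales (auto simp: algebra_simps)

lemma char2_m2_involution_algebra:
  "involution_algebra (m2_scale ((*) :: 'f::field \<Rightarrow> 'f \<Rightarrow> 'f)) (**) (mat 1) transpose"
  by unfold_locales
    (simp_all add: m2_scale_def vec_eq_iff transpose_def matrix_matrix_mult_def forall_2 sum_2 mat_def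
      algebra_simps)

lemma char2_support: "grading_support char2_group (char2_grading :: unit \<Rightarrow> 'f::field set) = UNIV"
proof -
  have "(UNIV :: 'f set) \<noteq> {0}" by (metis UNIV_I singletonD zero_neq_one)
  then show ?thesis by (simp add: grading_support_def)
qed

lemma char2_grading:
  "unital_algebra.is_grading ((*) :: 'f::field \<Rightarrow> 'f \<Rightarrow> 'f) (*) char2_group char2_grading"
proof -
  interpret involution_algebra "(*) :: 'f::field \<Rightarrow> 'f \<Rightarrow> 'f" "(*)" 1 id by (rule char2_involution_algebra)
  have "\<exists>!f. is_decomposition char2_group char2_grading a f" for a :: 'f
  proof -
    have *: "(\<Sum>g | f g \<noteq> 0. f g) = f ()" for f :: "unit \<Rightarrow> 'f"
    proof -
      have "(\<Sum>g | f g \<noteq> 0. f g) = (\<Sum>g\<in>UNIV. f g)"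
        by (rule sum.mono_neutral_left) auto
      then show ?thesis by (simp add: UNIV_unit)
    qed
    show ?thesis unfolding is_decomposition_def * by (rule ex1I[of _ "\<lambda>_. a"]) (auto intro: finite_subset[OF subset_UNIV])
  qed
  then show ?thesis unfolding is_grading_def is_decomposition_def[symmetric]
    using char2_comm_group subspace_UNIV by simp
qed

abbreviation (input) char2_base :: "(unit \<times> (2 \<Rightarrow>\<^sub>0 int)) monoid" where
  "char2_base \<equiv> tilde_base char2_group"

lemma char2_base_group: "comm_group char2_base"
proof (rule group.group_comm_groupI)
  show "group char2_base"
    using char2_comm_group by (intro DirProd_group group_free_Abelian_group) (simp add: comm_group_def)
qed (auto simp: add.commute)

abbreviation char2_rels where "char2_rels \<equiv> tilde_relations char2_group (\<lambda>_. ())"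

definition char2_deg :: "2 \<Rightarrow> 2 \<Rightarrow> (unit \<times> (2 \<Rightarrow>\<^sub>0 int)) set" where
  "char2_deg i j = char2_rels #>\<^bsub>char2_base\<^esub> ((), frag_of i - frag_of j)"

lemma char2_rels_eq: "char2_rels = generate char2_base {((), frag_cmul 2 (frag_of 1) - frag_cmul 2 (frag_of 2))}"
proof -
  interpret B: comm_group char2_base by (rule char2_base_group)
  have inv: "inv\<^bsub>char2_base\<^esub> ((), c) = ((), - c)" for c
    by (rule B.inv_equality) auto
  have "tilde_side char2_group (\<lambda>_. ()) i = ((), frag_cmul 2 (frag_of i))" for i
  proof -
    have pow: "x [^]\<^bsub>char2_base\<^esub> (2::nat) = x \<otimes>\<^bsub>char2_base\<^esub> x" for x
      by (cases x) (simp add: numeral_2_eq_2)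
    have "frag_cmul 2 c = c + c" for c :: "2 \<Rightarrow>\<^sub>0 int"
      using frag_cmul_distrib[of 1 1 c] by simp
    then show ?thesis by (simp add: tilde_side_def pow inv del: mult_2)
  qed
  then show ?thesis unfolding tilde_relations_def
    by (simp only: inv mult_DirProd mult_free_Abelian_group add_uminus_conv_diff) simp
qed

lemma char2_even_rels: "x \<in> char2_rels \<Longrightarrow> even (Poly_Mapping.lookup (snd x) 1)"
proof -
  interpret B: comm_group char2_base by (rule char2_base_group)
  have inv: "inv\<^bsub>char2_base\<^esub> ((), c) = ((), - c)" for c
    by (rule B.inv_equality) auto
  show "x \<in> char2_rels \<Longrightarrow> even (Poly_Mapping.lookup (snd x) 1)"
    unfolding char2_rels_eq
    by (induction rule: generate.induct) (auto simp: inv lookup_add lookup_minus)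
qed

lemma char2_rels_normal: "char2_rels \<lhd> char2_base"
proof -
  interpret B: comm_group char2_base by (rule char2_base_group)
  show ?thesis unfolding char2_rels_eq
    by (intro B.subgroup_imp_normal B.generate_is_subgroup) auto
qed

lemma char2_deg_eq:
  "tilde_gen char2_group (\<lambda>_. ()) i \<otimes>\<^bsub>tilde_group char2_group (\<lambda>_. ())\<^esub>
   inv\<^bsub>tilde_group char2_group (\<lambda>_. ())\<^esub> tilde_gen char2_group (\<lambda>_. ()) j
   \<otimes>\<^bsub>tilde_group char2_group (\<lambda>_. ())\<^esub> tilde_emb char2_group (\<lambda>_. ()) s = char2_deg i j"
proof -
  interpret B: comm_group char2_base by (rule char2_base_group)
  interpret N: normal char2_rels char2_base by (rule char2_rels_normal)
  have inv: "inv\<^bsub>char2_base\<^esub> ((), c) = ((), - c)" for c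
    by (rule B.inv_equality) auto
  have "char2_rels #>\<^bsub>char2_base\<^esub> ((), frag_of j) \<in> carrier (char2_base Mod char2_rels)"
    by (auto simp: FactGroup_def RCOSETS_def)
  then show ?thesis
    by (simp add: tilde_gen_def tilde_emb_def tilde_group_def char2_deg_def N.inv_FactGroup N.rcos_inv
        N.rcos_sum inv)
qed


lemma char2_deg:
  "char2_deg 1 1 = char2_rels" "char2_deg 2 2 = char2_rels" "char2_deg 2 1 = char2_deg 1 2" "char2_deg 1 2 \<noteq> char2_rels"
  "char2_deg i j \<in> carrier (char2_base Mod char2_rels)"
proof -
  interpret B: comm_group char2_base by (rule char2_base_group)
  interpret N: normal char2_rels char2_base by (rule char2_rels_normal)
  have inv: "inv\<^bsub>char2_base\<^esub> ((), c) = ((), - c)" for c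
    by (rule B.inv_equality) auto
  have "char2_rels #>\<^bsub>char2_base\<^esub> \<one>\<^bsub>char2_base\<^esub> = char2_rels" by (rule B.coset_mult_one) (rule N.subset)
  then show "char2_deg 1 1 = char2_rels" "char2_deg 2 2 = char2_rels" by (simp_all add: char2_deg_def)
  have two: "frag_cmul 2 c = c + c" for c :: "2 \<Rightarrow>\<^sub>0 int"
    using frag_cmul_distrib[of 1 1 c] by simp
  have "((), frag_cmul 2 (frag_of 1) - frag_cmul 2 (frag_of 2)) \<in> char2_rels"
    unfolding char2_rels_eq by (rule generate.incl) simp
  also have "((), frag_cmul 2 (frag_of 1) - frag_cmul 2 (frag_of 2)) =
      ((), frag_of 1 - frag_of 2) \<otimes>\<^bsub>char2_base\<^esub> inv\<^bsub>char2_base\<^esub> ((), frag_of 2 - frag_of (1::2))"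
    by (simp add: inv two algebra_simps del: mult_2)
  finally have "((), frag_of 1 - frag_of 2) \<in> char2_rels #>\<^bsub>char2_base\<^esub> ((), frag_of 2 - frag_of 1)"
    using N.rcos_module_rev[of "((), frag_of 2 - frag_of 1)" "((), frag_of 1 - frag_of 2)"] B.is_group
    by simp
  then have "char2_rels #>\<^bsub>char2_base\<^esub> ((), frag_of 2 - frag_of 1) = char2_rels #>\<^bsub>char2_base\<^esub> ((), frag_of 1 - frag_of 2)"
    by (intro B.repr_independence N.subgroup_axioms) auto
  then show "char2_deg 2 1 = char2_deg 1 2" by (simp add: char2_deg_def)
  show "char2_deg i j \<in> carrier (char2_base Mod char2_rels)" for i j
    by (auto simp: FactGroup_def RCOSETS_def char2_deg_def)
  have "((), frag_of 1 - frag_of 2) \<in> char2_deg 1 2"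
    unfolding char2_deg_def by (rule B.rcos_self) (auto intro: N.subgroup_axioms)
  moreover have "((), frag_of 1 - frag_of 2) \<notin> char2_rels"
    using char2_even_rels[of "((), frag_of 1 - frag_of 2)"] by (auto simp: lookup_minus)
  ultimately show "char2_deg 1 2 \<noteq> char2_rels" by auto
qed

lemma char2_deg_mult: "char2_deg i j \<otimes>\<^bsub>char2_base Mod char2_rels\<^esub> char2_deg j k = char2_deg i k"
proof -
  interpret N: normal char2_rels char2_base by (rule char2_rels_normal)
  show ?thesis by (simp add: char2_deg_def N.rcos_sum)
qed

lemma char2_component_subspace:
  "module.subspace (m2_scale ((*) :: 'f::field \<Rightarrow> 'f \<Rightarrow> 'f))
     {X. \<forall>i j. X $ i $ j \<noteq> 0 \<longrightarrow> char2_deg i j = \<gamma>}" (is "module.subspace _ ?C")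
proof -
  interpret M: involution_algebra "m2_scale ((*) :: 'f \<Rightarrow> 'f \<Rightarrow> 'f)" "(**)" "mat 1" transpose
    by (rule char2_m2_involution_algebra)
  show ?thesis unfolding M.subspace_def
  proof (intro conjI ballI allI)
    fix X Y assume XY: "X \<in> ?C" "Y \<in> ?C"
    have "char2_deg i j = \<gamma>" if "(X + Y) $ i $ j \<noteq> 0" for i j
    proof -
      have "X $ i $ j \<noteq> 0 \<or> Y $ i $ j \<noteq> 0" using that by auto
      then show ?thesis using XY by blast
    qed
    then show "X + Y \<in> ?C" by blast
  next
    fix c X assume X: "X \<in> ?C"
    have "char2_deg i j = \<gamma>" if "m2_scale (*) c X $ i $ j \<noteq> 0" for i j
    proof -
      have "X $ i $ j \<noteq> 0" using that by (auto simp: m2_scale_def)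
      then show ?thesis using X by blast
    qed
    then show "m2_scale (*) c X \<in> ?C" by blast
  next
    show "0 \<in> ?C" by simp
  qed
qed

lemma char2_m2_grading_eq:
  "m2_grading ((*) :: 'f::field \<Rightarrow> 'f \<Rightarrow> 'f) char2_group char2_grading d \<gamma> =
     {X. \<forall>i j. X $ i $ j \<noteq> 0 \<longrightarrow> char2_deg i j = \<gamma>}" (is "_ = ?C")
proof -
  interpret M: involution_algebra "m2_scale ((*) :: 'f \<Rightarrow> 'f \<Rightarrow> 'f)" "(**)" "mat 1" transpose
    by (rule char2_m2_involution_algebra)
  let ?S = "{m2_elem i j (x::'f) | i j x. char2_deg i j = \<gamma>}"
  have "M.span ?S = ?C"
  proof
    have sub: "M.subspace ?C" by (rule char2_component_subspace)
    have "m2_elem i j x \<in> ?C" if "char2_deg i j = \<gamma>" for i j and x :: 'f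
    proof -
      have "char2_deg k l = \<gamma>" if "m2_elem i j x $ k $ l \<noteq> 0" for k l
        using that \<open>char2_deg i j = \<gamma>\<close> by (cases "k = i \<and> l = j") (simp_all add: m2_elem_def)
      then show ?thesis by blast
    qed
    then have "?S \<subseteq> ?C" by blast
    with sub show "M.span ?S \<subseteq> ?C" by (intro M.span_minimal)
    show "?C \<subseteq> M.span ?S"
    proof
      fix X assume X: "X \<in> ?C"
      have *: "m2_elem i j (X $ i $ j) \<in> M.span ?S" for i j
      proof (cases "X $ i $ j = 0")
        case True
        then have "m2_elem i j (X $ i $ j) = 0" by (simp add: m2_elem_def vec_eq_iff)
        then show ?thesis by (simp only: M.span_zero)
      next
        case False
        then have "char2_deg i j = \<gamma>" using X by blast
        then have "m2_elem i j (X $ i $ j) \<in> ?S" by blast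
        then show ?thesis by (rule M.span_base)
      qed
      have "X = m2_elem 1 1 (X $ 1 $ 1) + m2_elem 1 2 (X $ 1 $ 2) + m2_elem 2 1 (X $ 2 $ 1) + m2_elem 2 2 (X $ 2 $ 2)"
        by (simp add: vec_eq_iff m2_elem_def forall_2)
      also have "\<dots> \<in> M.span ?S" by (intro M.span_add *)
      finally show "X \<in> M.span ?S" .
    qed
  qed
  then show ?thesis
    unfolding m2_grading_def Let_def char2_support by (simp add: char2_deg_eq)
qed

lemma char2_m2_group_eq: "m2_group char2_group (char2_grading :: unit \<Rightarrow> 'f::field set) d = char2_base Mod char2_rels"
  by (simp add: m2_group_def char2_support tilde_group_def)

lemma char2_m2_is_inv_grading:
  "involution_algebra.is_inv_grading (m2_scale ((*) :: 'f::field \<Rightarrow> 'f \<Rightarrow> 'f)) (**) transpose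
     (char2_base Mod char2_rels) (\<lambda>\<gamma>. {X. \<forall>i j. X $ i $ j \<noteq> 0 \<longrightarrow> char2_deg i j = \<gamma>})"
proof -
  interpret B: comm_group char2_base by (rule char2_base_group)
  interpret N: normal char2_rels char2_base by (rule char2_rels_normal)
  interpret M: involution_algebra "m2_scale ((*) :: 'f \<Rightarrow> 'f \<Rightarrow> 'f)" "(**)" "mat 1" transpose
    by (rule char2_m2_involution_algebra)
  define C where "C = (\<lambda>\<gamma>. {X :: 'f^2^2. \<forall>i j. X $ i $ j \<noteq> 0 \<longrightarrow> char2_deg i j = \<gamma>})"
  let ?K = "char2_base Mod char2_rels"
  have ij: "char2_deg i j \<in> {char2_deg 1 1, char2_deg 1 2}" for i j
    using exhaust_2[of i] exhaust_2[of j] char2_deg by auto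
  have ex1: "\<exists>!f. M.is_decomposition ?K C X f" for X
  proof (rule ex1I)
    let ?f = "\<lambda>\<gamma>. (\<chi> i j. if char2_deg i j = \<gamma> then X $ i $ j else 0)"
    have z: "?f \<gamma> = 0" if "\<gamma> \<notin> {char2_deg 1 1, char2_deg 1 2}" for \<gamma>
      using that ij by (auto simp: vec_eq_iff)
    have "(\<Sum>\<gamma> | ?f \<gamma> \<noteq> 0. ?f \<gamma>) = (\<Sum>\<gamma>\<in>{char2_deg 1 1, char2_deg 1 2}. ?f \<gamma>)"
      by (rule sum.mono_neutral_left) (use z in auto)
    also have "\<dots> = X" using char2_deg by (simp add: vec_eq_iff forall_2)
    finally have sum: "(\<Sum>\<gamma> | ?f \<gamma> \<noteq> 0. ?f \<gamma>) = X" .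
    have fin: "finite {\<gamma>. ?f \<gamma> \<noteq> 0}"
      by (rule finite_subset[of _ "{char2_deg 1 1, char2_deg 1 2}"]) (use z in \<open>auto simp del: insert_iff\<close>)
    show "M.is_decomposition ?K C X ?f"
      unfolding M.is_decomposition_def
    proof (intro conjI ballI allI impI)
      show "?f \<gamma> \<in> C \<gamma>" for \<gamma> by (simp add: C_def)
      show "?f \<gamma> = 0" if "\<gamma> \<notin> carrier ?K" for \<gamma> by (rule z) (use that char2_deg(5) in auto)
    qed (simp_all only: sum fin)
    fix f assume f: "M.is_decomposition ?K C X f"
    have z': "f \<gamma> = 0" if "\<gamma> \<notin> {char2_deg 1 1, char2_deg 1 2}" for \<gamma>
    proof (cases "\<gamma> \<in> carrier ?K")
      case True
      then have "f \<gamma> \<in> C \<gamma>" using f by (auto simp: M.is_decomposition_def)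
      have "f \<gamma> $ i $ j = 0" for i j
      proof (rule ccontr)
        assume "f \<gamma> $ i $ j \<noteq> 0"
        then have "char2_deg i j = \<gamma>" using \<open>f \<gamma> \<in> C \<gamma>\<close> unfolding C_def by blast
        then show False using that ij[of i j] by simp
      qed
      then show ?thesis by (simp add: vec_eq_iff)
    qed (use f in \<open>auto simp: M.is_decomposition_def\<close>)
    have "X = (\<Sum>\<gamma> | f \<gamma> \<noteq> 0. f \<gamma>)" using f by (auto simp: M.is_decomposition_def)
    also have "\<dots> = (\<Sum>\<gamma>\<in>{char2_deg 1 1, char2_deg 1 2}. f \<gamma>)"
      by (rule sum.mono_neutral_left) (use z' in auto)
    finally have X: "X = f (char2_deg 1 1) + f (char2_deg 1 2)" using char2_deg by simp
    have "f (char2_deg 1 1) \<in> C (char2_deg 1 1)" "f (char2_deg 1 2) \<in> C (char2_deg 1 2)"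
      using f char2_deg(5) by (auto simp: M.is_decomposition_def)
    then have "f \<gamma> = ?f \<gamma>" if "\<gamma> \<in> {char2_deg 1 1, char2_deg 1 2}" for \<gamma>
      using that char2_deg unfolding X by (auto simp: C_def vec_eq_iff forall_2)
    then show "f = ?f" using z z' by (metis (no_types, lifting) ext)
  qed
  have "M.is_grading ?K C"
    unfolding M.is_grading_def M.is_decomposition_def[symmetric]
  proof (intro conjI ballI allI)
    show "comm_group ?K" by (rule B.abelian_FactGroup) (rule N.subgroup_axioms)
    show "\<exists>!f. M.is_decomposition ?K C X f" for X by (rule ex1)
    show "M.subspace (C \<gamma>)" for \<gamma>
      unfolding C_def by (rule char2_component_subspace)
    show "X ** Y \<in> C (\<gamma> \<otimes>\<^bsub>?K\<^esub> \<gamma>')" if "X \<in> C \<gamma>" "Y \<in> C \<gamma>'" for X Y \<gamma> \<gamma>'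
      unfolding C_def mem_Collect_eq
    proof (intro allI impI)
      fix i j assume "(X ** Y) $ i $ j \<noteq> 0"
      then obtain k where "X $ i $ k \<noteq> 0" "Y $ k $ j \<noteq> 0"
        unfolding matrix_matrix_mult_def by (auto elim!: sum.not_neutral_contains_not_neutral)
      then show "char2_deg i j = \<gamma> \<otimes>\<^bsub>?K\<^esub> \<gamma>'" using that char2_deg_mult[of i k j] by (auto simp: C_def)
    qed
  qed
  moreover have "transpose ` C \<gamma> \<subseteq> C \<gamma>" for \<gamma>
  proof
    fix Y assume "Y \<in> transpose ` C \<gamma>"
    then obtain X where X: "X \<in> C \<gamma>" "Y = transpose X" by blast
    have sym: "char2_deg i j = char2_deg j i" for i j
      using exhaust_2[of i] exhaust_2[of j] char2_deg(3) by auto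
    have "char2_deg i j = \<gamma>" if "Y $ i $ j \<noteq> 0" for i j
    proof -
      have "X $ j $ i \<noteq> 0" using that X(2) by (simp add: transpose_def)
      then show ?thesis using X(1) unfolding C_def sym[of i j] by blast
    qed
    then show "Y \<in> C \<gamma>" unfolding C_def by blast
  qed
  ultimately show ?thesis by (simp add: M.is_inv_grading_def C_def)
qed

lemma char2_m2_no_proper_refinement:
  assumes two: "\<And>x :: 'f::field. x = 0 \<or> x = 1"
    and inv_gr: "involution_algebra.is_inv_grading (m2_scale ((*) :: 'f \<Rightarrow> 'f \<Rightarrow> 'f)) (**) transpose H \<Delta>"
    and ref: "is_proper_refinement H \<Delta> K (\<lambda>\<gamma>. {X. \<forall>i j. X $ i $ j \<noteq> 0 \<longrightarrow> char2_deg i j = \<gamma>})"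
  shows False
proof -
  interpret M: involution_algebra "m2_scale ((*) :: 'f \<Rightarrow> 'f \<Rightarrow> 'f)" "(**)" "mat 1" transpose
    by (rule char2_m2_involution_algebra)
  have gr: "M.is_grading H \<Delta>" and tr: "\<And>h X. h \<in> carrier H \<Longrightarrow> X \<in> \<Delta> h \<Longrightarrow> transpose X \<in> \<Delta> h"
    using inv_gr by (auto simp: M.is_inv_grading_def)
  interpret H: comm_group H using gr by (simp add: M.is_grading_def)
  have sub: "M.subspace (\<Delta> h)" if "h \<in> carrier H" for h using gr that by (simp add: M.is_grading_def)
  have mult: "X ** Y \<in> \<Delta> (h \<otimes>\<^bsub>H\<^esub> k)" if "h \<in> carrier H" "k \<in> carrier H" "X \<in> \<Delta> h" "Y \<in> \<Delta> k" for h k X Y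
    using gr that unfolding M.is_grading_def by blast
  define diag where "diag X \<longleftrightarrow> X $ 1 $ 2 = 0 \<and> X $ 2 $ 1 = 0" for X :: "'f^2^2"
  define anti where "anti X \<longleftrightarrow> X $ 1 $ 1 = 0 \<and> X $ 2 $ 2 = 0" for X :: "'f^2^2"
  let ?E = "\<lambda>i j. m2_elem i j (1::'f)"
  have one: "mat 1 \<in> \<Delta> \<one>\<^bsub>H\<^esub>" by (rule M.unit_homogeneous[OF gr])
  have C: "(\<forall>X\<in>{X. \<forall>i j. X $ i $ j \<noteq> 0 \<longrightarrow> char2_deg i j = \<gamma>}. diag X) \<or>
    (\<forall>X\<in>{X. \<forall>i j. X $ i $ j \<noteq> 0 \<longrightarrow> char2_deg i j = \<gamma>}. anti X)" (is "(\<forall>X\<in>?C. _) \<or> _") for \<gamma>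
  proof (cases "\<gamma> = char2_rels")
    case True
    have "diag X" if "X \<in> ?C" for X
    proof -
      have "X $ i $ j = 0" if "char2_deg i j \<noteq> \<gamma>" for i j using that \<open>X \<in> ?C\<close> by blast
      then show ?thesis using True char2_deg unfolding diag_def by metis
    qed
    then show ?thesis by blast
  next
    case False
    have "anti X" if "X \<in> ?C" for X
    proof -
      have "X $ i $ j = 0" if "char2_deg i j \<noteq> \<gamma>" for i j using that \<open>X \<in> ?C\<close> by blast
      then show ?thesis using False char2_deg unfolding anti_def by metis
    qed
    then show ?thesis by blast
  qed
  have hom: "(\<forall>X\<in>\<Delta> h. diag X) \<or> (\<forall>X\<in>\<Delta> h. anti X)" if h: "h \<in> carrier H" for h
  proof -
    obtain \<gamma> where "\<Delta> h \<subseteq> {X. \<forall>i j. X $ i $ j \<noteq> 0 \<longrightarrow> char2_deg i j = \<gamma>}"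
      using ref h unfolding is_proper_refinement_def is_refinement_def by blast
    then show ?thesis using C[of \<gamma>] by blast
  qed
  have one_ne: "(mat 1 :: 'f^2^2) \<noteq> 0" by (simp add: mat_def vec_eq_iff forall_2)
  have diag_e: "h = \<one>\<^bsub>H\<^esub>" if h: "h \<in> carrier H" and X: "X \<in> \<Delta> h" "X \<noteq> 0" "diag X" for h X
  proof (cases "X = mat 1")
    case True
    then show ?thesis using M.component_disjoint[OF gr h H.one_closed, of X] X one by blast
  next
    case False
    have "X = ?E 1 1 \<or> X = ?E 2 2"
      using X False two[of "X $ 1 $ 1"] two[of "X $ 2 $ 2"]
      by (auto simp: diag_def m2_elem_def vec_eq_iff forall_2 mat_def)
    then have "X ** X = X"
      by (auto simp: m2_elem_def vec_eq_iff forall_2 matrix_matrix_mult_def sum_2)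
    then have "X \<in> \<Delta> (h \<otimes>\<^bsub>H\<^esub> h)" using mult[OF h h X(1) X(1)] by simp
    then have "h \<otimes>\<^bsub>H\<^esub> h = h" using M.component_disjoint[OF gr _ h, of "h \<otimes>\<^bsub>H\<^esub> h" X] X h by simp
    then show ?thesis using h by simp
  qed
  have e_diag: "diag X" if "X \<in> \<Delta> \<one>\<^bsub>H\<^esub>" for X
    using hom[OF H.one_closed] one that by (force simp: diag_def anti_def mat_def)
  have E: "X \<in> \<Delta> \<one>\<^bsub>H\<^esub>" if X: "diag X" for X
  proof -
    obtain f where f: "M.is_decomposition H \<Delta> X f" by (rule M.decomposition_exists[OF gr])
    define S where "S = {g. f g \<noteq> 0}"
    have S: "finite S" "S \<subseteq> carrier H" "X = (\<Sum>g\<in>S. f g)"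
      using f by (auto simp: M.is_decomposition_def S_def)
    have fH: "f g \<in> \<Delta> g" if "g \<in> carrier H" for g using f that by (simp add: M.is_decomposition_def)
    have anti: "anti (f g)" if "g \<in> S - {\<one>\<^bsub>H\<^esub>}" for g
      using that hom[of g] diag_e[of g "f g"] fH[of g] S by (auto simp: S_def)
    have "X = f \<one>\<^bsub>H\<^esub> + (\<Sum>g\<in>S - {\<one>\<^bsub>H\<^esub>}. f g)"
      using S sum.remove[of S "\<one>\<^bsub>H\<^esub>" f] by (cases "\<one>\<^bsub>H\<^esub> \<in> S") (auto simp: S_def)
    moreover have "anti (\<Sum>g\<in>S - {\<one>\<^bsub>H\<^esub>}. f g)"
      using anti by (simp add: anti_def)
    moreover have "diag (f \<one>\<^bsub>H\<^esub>)" using fH e_diag by simp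
    ultimately have "X = f \<one>\<^bsub>H\<^esub>"
      using X by (auto simp: diag_def anti_def vec_eq_iff forall_2)
    then show ?thesis using fH[OF H.one_closed] by simp
  qed
  have A: "Y \<in> \<Delta> h" if h: "h \<in> carrier H" and X: "X \<in> \<Delta> h" "X \<noteq> 0" "anti X" and Y: "anti Y" for h X Y
  proof -
    have E11: "?E 1 1 \<in> \<Delta> \<one>\<^bsub>H\<^esub>" by (rule E) (simp add: diag_def m2_elem_def)
    have mem: "?E 1 1 ** X \<in> \<Delta> h" "X ** ?E 1 1 \<in> \<Delta> h"
      using mult[OF H.one_closed h E11 X(1)] mult[OF h H.one_closed X(1) E11] h by simp_all
    have "?E 1 2 \<in> \<Delta> h \<or> ?E 2 1 \<in> \<Delta> h"
    proof (cases "X $ 1 $ 2 = 0")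
      case True
      then have "X ** ?E 1 1 = ?E 2 1" using X two[of "X $ 2 $ 1"]
        by (auto simp: anti_def m2_elem_def vec_eq_iff forall_2 matrix_matrix_mult_def sum_2)
      then show ?thesis using mem by simp
    next
      case False
      then have "?E 1 1 ** X = ?E 1 2" using X two[of "X $ 1 $ 2"]
        by (auto simp: anti_def m2_elem_def vec_eq_iff forall_2 matrix_matrix_mult_def sum_2)
      then show ?thesis using mem by simp
    qed
    moreover have "transpose (?E 1 2) = ?E 2 1" "transpose (?E 2 1) = ?E 1 2"
      by (auto simp: transpose_def m2_elem_def vec_eq_iff)
    ultimately have "?E 1 2 \<in> \<Delta> h" "?E 2 1 \<in> \<Delta> h" using tr[OF h] by metis+
    then have "m2_scale (*) (Y $ 1 $ 2) (?E 1 2) + m2_scale (*) (Y $ 2 $ 1) (?E 2 1) \<in> \<Delta> h"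
      using sub[OF h] by (intro M.subspace_add M.subspace_scale)
    also have "m2_scale (*) (Y $ 1 $ 2) (?E 1 2) + m2_scale (*) (Y $ 2 $ 1) (?E 2 1) = Y"
      using Y by (simp add: m2_scale_def m2_elem_def vec_eq_iff forall_2 anti_def)
    finally show ?thesis .
  qed
  obtain h \<gamma> where h: "h \<in> carrier H" "\<Delta> h \<noteq> {0}"
    and lt: "\<Delta> h \<subset> {X. \<forall>i j. X $ i $ j \<noteq> 0 \<longrightarrow> char2_deg i j = \<gamma>}" (is "_ \<subset> ?C")
    using ref unfolding is_proper_refinement_def by blast
  obtain X where X: "X \<in> \<Delta> h" "X \<noteq> 0" using h M.subspace_0[OF sub[OF h(1)]] by blast
  have "?C \<subseteq> \<Delta> h"
  proof
    fix Y assume Y: "Y \<in> ?C"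
    have "diag X \<and> diag Y \<or> anti X \<and> anti Y" using C[of \<gamma>] Y X lt by blast
    then show "Y \<in> \<Delta> h" using A[OF h(1) X] E diag_e[OF h(1) X] by blast
  qed
  then show False using lt by blast
qed


theorem char2_counterexample:
  defines "d \<equiv> (1 :: bit^2)"
  shows "CHAR(bit) = 2"
    and "involution_algebra ((*) :: bit \<Rightarrow> bit \<Rightarrow> bit) (*) 1 id"
    and "unital_algebra.finite_dim ((*) :: bit \<Rightarrow> bit \<Rightarrow> bit)"
    and "unital_algebra.is_division_grading ((*) :: bit \<Rightarrow> bit \<Rightarrow> bit) (*) 1 char2_group char2_grading"
    and "unital_algebra.one_dim_components ((*) :: bit \<Rightarrow> bit \<Rightarrow> bit) char2_group char2_grading"
    and "involution_algebra.is_inv_grading ((*) :: bit \<Rightarrow> bit \<Rightarrow> bit) (*) id char2_group char2_grading"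
    and "involution_algebra.central_simple ((*) :: bit \<Rightarrow> bit \<Rightarrow> bit) (*) 1 id"
    and "d $ i \<in> nonzero_homogeneous char2_group char2_grading"
    and "id (d $ i) = 1 * (d $ i)"
    and "involution_algebra.is_fine (m2_scale ((*) :: bit \<Rightarrow> bit \<Rightarrow> bit)) (**) (m2_involution id d)
           (m2_group char2_group char2_grading d) (m2_grading (*) char2_group char2_grading d)"
    and "hom_degree char2_group char2_grading (d $ 1) = hom_degree char2_group char2_grading (d $ 2)"
proof -
  interpret D: involution_algebra "(*) :: bit \<Rightarrow> bit \<Rightarrow> bit" "(*)" 1 id by (rule char2_involution_algebra)
  interpret M: involution_algebra "m2_scale ((*) :: bit \<Rightarrow> bit \<Rightarrow> bit)" "(**)" "mat 1" transpose
    by (rule char2_m2_involution_algebra)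
  have two: "x = 0 \<or> x = 1" for x :: bit by (cases x) simp_all
  show char: "CHAR(bit) = 2"
  proof (rule CHAR_eqI)
    show "of_nat 2 = (0 :: bit)" by simp
    show "2 dvd n" if "of_nat n = (0 :: bit)" for n using that even_of_nat[of n, where ?'a = bit] by (metis dvd_0_right)
  qed
  show "involution_algebra ((*) :: bit \<Rightarrow> bit \<Rightarrow> bit) (*) 1 id" by (rule char2_involution_algebra)
  have fin: "finite (UNIV :: bit set)"
  proof (rule finite_subset)
    show "(UNIV :: bit set) \<subseteq> {0, 1}" using two by blast
  qed simp
  show "D.finite_dim" unfolding D.finite_dim_def
    using fin vector_space_over_itself.span_UNIV by blast
  show "D.is_division_grading char2_group char2_grading"
    unfolding D.is_division_grading_def
  proof (intro conjI ballI char2_grading)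
    show "\<exists>y. x * y = 1 \<and> y * x = 1" if "x \<in> nonzero_homogeneous char2_group char2_grading" for x :: bit
      using that two[of x] by (auto simp: nonzero_homogeneous_def)
  qed
  have "x \<in> vector_space_over_itself.span {1}" for x :: bit
    using vector_space_over_itself.span_scale[OF vector_space_over_itself.span_base[OF singletonI[of "1 :: bit"]], of x]
    by (simp only: mult_1_right)
  then have "vector_space_over_itself.span {1} = (UNIV :: bit set)" by blast
  then have "vector_space_over_itself.dim (UNIV :: bit set) = card {1 :: bit}"
    by (intro vector_space_over_itself.dim_eq_card)
      (simp_all only: vector_space_over_itself.span_UNIV vector_space_over_itself.dependent_single one_neq_zero simp_thms)
  also have "card {1 :: bit} = 1" by simp
  finally have "vector_space_over_itself.dim (UNIV :: bit set) = 1" .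
  then show "D.one_dim_components char2_group char2_grading"
    unfolding D.one_dim_components_def by blast
  show "D.is_inv_grading char2_group char2_grading"
    unfolding D.is_inv_grading_def by (intro conjI ballI char2_grading subset_UNIV)
  show "D.central_simple"
    unfolding D.central_simple_def
  proof (intro conjI allI impI)
    fix I :: "bit set" assume I: "D.two_sided_ideal I \<and> id ` I \<subseteq> I"
    then have 0: "0 \<in> I" using vector_space_over_itself.subspace_0 unfolding D.two_sided_ideal_def by blast
    show "I = {0} \<or> I = UNIV"
    proof (cases "1 \<in> I")
      case True
      then have "x \<in> I" for x using two[of x] 0 by metis
      then show ?thesis by blast
    next
      case False
      then have "x = 0" if "x \<in> I" for x using two[of x] that by metis
      then show ?thesis using 0 by blast
    qed
  next
    show "{z \<in> D.center. id z = z} = range (\<lambda>c. c * 1)" 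
    proof -
      have "D.center = UNIV" unfolding D.center_def by (simp only: mult.commute) simp
      moreover have "range (\<lambda>c :: bit. c * 1) = UNIV" by (simp only: mult_1_right) simp
      ultimately show ?thesis by (simp only: id_apply) simp
    qed
  qed
  show "d $ i \<in> nonzero_homogeneous char2_group char2_grading"
    by (simp add: nonzero_homogeneous_def d_def)
  show "id (d $ i) = 1 * (d $ i)" by simp
  have diag: "m2_diag d = mat 1" by (simp add: m2_diag_def mat_def d_def vec_eq_iff)
  have "matrix_inv (mat 1 :: bit^2^2) = mat 1"
    unfolding matrix_inv_def by (rule some_equality) (simp_all add: matrix_mul_lid matrix_mul_rid)
  then have inv: "m2_involution id d = transpose"
    by (rule_tac ext) (simp add: m2_involution_def diag)
  have "M.is_fine (char2_base Mod char2_rels) (\<lambda>\<gamma>. {X. \<forall>i j. X $ i $ j \<noteq> 0 \<longrightarrow> char2_deg i j = \<gamma>})"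
    unfolding M.is_fine_def using char2_m2_is_inv_grading char2_m2_no_proper_refinement[OF two] by blast
  moreover have "m2_grading ((*) :: bit \<Rightarrow> bit \<Rightarrow> bit) char2_group char2_grading d =
      (\<lambda>\<gamma>. {X. \<forall>i j. X $ i $ j \<noteq> 0 \<longrightarrow> char2_deg i j = \<gamma>})"
    by (rule ext) (rule char2_m2_grading_eq)
  ultimately show "involution_algebra.is_fine (m2_scale ((*) :: bit \<Rightarrow> bit \<Rightarrow> bit)) (**) (m2_involution id d)
           (m2_group char2_group char2_grading d) (m2_grading (*) char2_group char2_grading d)"
    unfolding inv char2_m2_group_eq by simp
  show "hom_degree char2_group char2_grading (d $ 1) = hom_degree char2_group char2_grading (d $ 2)"
    by simp
qed

end

theory Submission
  imports Defs
begin

text \<open>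
  Write \<open>\<phi>(X) = \<Phi>\<inverse> \<phi>\<^sub>0(X\<^sup>T) \<Phi>\<close> and let \<open>V\<close> be the grading of \<open>M\<^sub>2(D)\<close>. Its components are spanned by
  \<open>E\<^sub>1\<^sub>1 \<otimes> x, E\<^sub>2\<^sub>2 \<otimes> x\<close> or by \<open>E\<^sub>1\<^sub>2 \<otimes> x\<close> and its image under \<open>\<phi>\<close>.

  If \<open>deg d\<^sub>1 = deg d\<^sub>2\<close>, then \<open>d\<^sub>1 = c d\<^sub>2\<close> with a scalar \<open>c\<close>, and conjugation by \<open>E\<^sub>1\<^sub>2 + c E\<^sub>2\<^sub>1\<close> is an
  automorphism of order 2 that commutes with \<open>\<phi>\<close> and preserves the components of \<open>V\<close>. As the
  characteristic is not 2, its eigenspaces refine \<open>V\<close> properly.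

  Conversely, let \<open>deg d\<^sub>1 \<noteq> deg d\<^sub>2\<close> and let \<open>\<Delta>\<close> refine \<open>V\<close>. If \<open>E\<^sub>1\<^sub>1\<close> has neutral degree in \<open>\<Delta>\<close>, then
  the matrix units are homogeneous; multiplying by them and applying \<open>\<phi>\<close> shows that no component of
  \<open>V\<close> is split. Otherwise \<open>a = E\<^sub>1\<^sub>1 - E\<^sub>2\<^sub>2\<close> is homogeneous of some degree \<open>h \<noteq> 1\<close>. Since \<open>d\<^sub>2 d\<^sub>1\<inverse>\<close> is not
  central, some homogeneous \<open>x\<close> satisfies \<open>d\<^sub>i\<inverse> x d\<^sub>i = \<epsilon>\<^sub>i x\<close> with signs \<open>\<epsilon>\<^sub>1 \<noteq> \<epsilon>\<^sub>2\<close>. A nonzero homogeneous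
  \<open>z\<close> in the span of \<open>E\<^sub>1\<^sub>1 \<otimes> x, E\<^sub>2\<^sub>2 \<otimes> x\<close> then has \<open>\<phi>(z) = \<plusminus>a z\<close>, and comparing degrees gives \<open>h = 1\<close>.
\<close>


section \<open>Gradings of algebras with involution\<close>

context unital_algebra
begin

lemma mul_zero_left: "0 \<star> x = 0"
  using mul_scale_left[of 0 0 x] by simp

lemma mul_zero_right: "x \<star> 0 = 0"
  using mul_scale_right[of x 0 0] by simp

lemma mul_sum_left: "(\<Sum>i\<in>A. f i) \<star> y = (\<Sum>i\<in>A. f i \<star> y)"
  by (induction A rule: infinite_finite_induct) (simp_all add: mul_zero_left mul_add_left)

lemma mul_sum_right: "y \<star> (\<Sum>i\<in>A. f i) = (\<Sum>i\<in>A. y \<star> f i)"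
  by (induction A rule: infinite_finite_induct) (simp_all add: mul_zero_right mul_add_right)

text \<open>Unique existence of a finitely supported decomposition splits into spanning and
  independence: two decompositions are subtracted on the union of their supports, and independence
  makes every difference vanish.\<close>

lemma is_gradingI:
  assumes "comm_group G"
    and sub: "\<And>g. g \<in> carrier G \<Longrightarrow> subspace (\<Gamma> g)"
    and ex: "\<And>a. \<exists>S f. finite S \<and> S \<subseteq> carrier G \<and> (\<forall>g\<in>S. f g \<in> \<Gamma> g) \<and> a = (\<Sum>g\<in>S. f g)"
    and indep: "\<And>S f g. \<lbrakk>finite S; S \<subseteq> carrier G; \<And>g. g \<in> S \<Longrightarrow> f g \<in> \<Gamma> g; (\<Sum>g\<in>S. f g) = 0; g \<in> S\<rbrakk>
      \<Longrightarrow> f g = 0"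
    and mul: "\<And>g h x y. \<lbrakk>g \<in> carrier G; h \<in> carrier G; x \<in> \<Gamma> g; y \<in> \<Gamma> h\<rbrakk> \<Longrightarrow> x \<star> y \<in> \<Gamma> (g \<otimes>\<^bsub>G\<^esub> h)"
  shows "is_grading G \<Gamma>"
proof -
  have "\<exists>!f. is_decomposition G \<Gamma> a f" for a
  proof -
    obtain S f where S: "finite S" "S \<subseteq> carrier G" "\<And>g. g \<in> S \<Longrightarrow> f g \<in> \<Gamma> g" "a = (\<Sum>g\<in>S. f g)"
      using ex[of a] by blast
    let ?f = "\<lambda>g. if g \<in> S then f g else 0"
    have "(\<Sum>g | ?f g \<noteq> 0. ?f g) = (\<Sum>g\<in>S. f g)"
      by (rule sum.mono_neutral_cong_left) (use S in \<open>auto split: if_splits\<close>)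
    moreover have "finite {g. ?f g \<noteq> 0}"
      by (rule finite_subset[OF _ S(1)]) auto
    ultimately have 1: "is_decomposition G \<Gamma> a ?f"
      using S sub subspace_0 unfolding is_decomposition_def by auto
    have "u = v" if u: "is_decomposition G \<Gamma> a u" and v: "is_decomposition G \<Gamma> a v" for u v
    proof
      fix g
      let ?U = "{g. u g \<noteq> 0} \<union> {g. v g \<noteq> 0}"
      have U: "finite ?U" "?U \<subseteq> carrier G" using u v by (auto simp: is_decomposition_def)
      have "(\<Sum>g\<in>?U. u g) = a" "(\<Sum>g\<in>?U. v g) = a"
        using u v U(1) unfolding is_decomposition_def
        by (metis (mono_tags, lifting) DiffD2 Un_upper1 Un_upper2 mem_Collect_eq sum.mono_neutral_right)+
      then have "(\<Sum>g\<in>?U. u g - v g) = 0" by (simp add: sum_subtractf)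
      moreover have "u h - v h \<in> \<Gamma> h" if "h \<in> ?U" for h
        using that U u v sub subspace_diff unfolding is_decomposition_def by blast
      ultimately have "u g - v g = 0" if "g \<in> ?U" using indep[of ?U "\<lambda>g. u g - v g" g] U that by blast
      then show "u g = v g" by (cases "g \<in> ?U") auto
    qed
    with 1 show ?thesis by blast
  qed
  then show ?thesis
    using assms(1) sub mul unfolding is_grading_def is_decomposition_def[symmetric] by blast
qed

lemma grading_sum:
  assumes "is_grading G \<Gamma>"
  obtains S f where "finite S" "S \<subseteq> carrier G" "\<And>g. g \<in> S \<Longrightarrow> f g \<in> \<Gamma> g" "a = (\<Sum>g\<in>S. f g)"
proof -
  obtain f where "is_decomposition G \<Gamma> a f" by (rule decomposition_exists[OF assms])
  then show ?thesis by (intro that[of "{g. f g \<noteq> 0}" f]) (auto simp: is_decomposition_def)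
qed

lemma grading_independent:
  assumes gr: "is_grading G \<Gamma>" and S: "finite S" "S \<subseteq> carrier G" "\<And>g. g \<in> S \<Longrightarrow> f g \<in> \<Gamma> g"
    and 0: "(\<Sum>g\<in>S. f g) = 0" and g: "g \<in> S"
  shows "f g = 0"
proof -
  have "is_decomposition G \<Gamma> 0 (\<lambda>g. if g \<in> S then f g else 0)"
    using decompositionI[OF gr S] 0 by simp
  moreover have "is_decomposition G \<Gamma> 0 (\<lambda>g. if g \<in> {} then f g else 0)"
    using decompositionI[OF gr, of "{}" f] by simp
  ultimately have "(\<lambda>g. if g \<in> S then f g else 0) = (\<lambda>g. if g \<in> {} then f g else 0)"
    by (rule decomposition_unique[OF gr])
  from fun_cong[OF this, of g] g show ?thesis by simp
qed

lemma grading_subspace: "is_grading G \<Gamma> \<Longrightarrow> g \<in> carrier G \<Longrightarrow> subspace (\<Gamma> g)"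
  by (simp add: is_grading_def)

lemma grading_mul:
  "\<lbrakk>is_grading G \<Gamma>; g \<in> carrier G; h \<in> carrier G; x \<in> \<Gamma> g; y \<in> \<Gamma> h\<rbrakk> \<Longrightarrow> x \<star> y \<in> \<Gamma> (g \<otimes>\<^bsub>G\<^esub> h)"
  by (simp add: is_grading_def)

text \<open>Both sides decompose the same element, once in degree \<open>k\<close> and once in
  degrees \<open>g\<close> and \<open>h\<close>. Since \<open>k\<close> equals at most one of
  \<open>g\<close> and \<open>h\<close>, uniqueness kills the other summand.\<close>

lemma homogeneous_add_cases:
  assumes gr: "is_grading G \<Gamma>" and c: "k \<in> carrier G" "g \<in> carrier G" "h \<in> carrier G"
    and x: "y + z \<in> \<Gamma> k" "y \<in> \<Gamma> g" "z \<in> \<Gamma> h" and ne: "g \<noteq> h"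
  shows "y = 0 \<or> z = 0"
proof -
  let ?f = "\<lambda>l. if l = g then y else z" and ?e = "\<lambda>l. if l \<in> {k} then y + z else 0"
  have "is_decomposition G \<Gamma> (\<Sum>l\<in>{g, h}. ?f l) (\<lambda>l. if l \<in> {g, h} then ?f l else 0)"
    by (rule decompositionI[OF gr]) (use c x ne in auto)
  moreover have "(\<Sum>l\<in>{g, h}. ?f l) = (\<Sum>l\<in>{k}. y + z)" using ne by auto
  ultimately have "(\<lambda>l. if l \<in> {g, h} then ?f l else 0) = (\<lambda>l. if l \<in> {k} then y + z else 0)"
    using decompositionI[OF gr, of "{k}" "\<lambda>_. y + z"] c x
    by (intro decomposition_unique[OF gr, of "y + z"]) auto
  from fun_cong[OF this, of g] fun_cong[OF this, of h] ne show ?thesis by (auto split: if_splits)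
qed

text \<open>Taking for \<open>W\<close> the kernel of a linear map yields a homogeneous element of a component of the
  refinement on which that map does not vanish.\<close>

lemma refinement_part:
  assumes gr: "is_grading G \<Gamma>" and grH: "is_grading H \<Delta>" and ref: "is_refinement H \<Delta> G \<Gamma>"
    and x: "x \<in> \<Gamma> g" "g \<in> carrier G" and W: "subspace W" "x \<notin> W"
  obtains h y where "h \<in> carrier H" "y \<in> \<Delta> h" "y \<in> \<Gamma> g" "y \<notin> W"
proof -
  obtain S f where S: "finite S" "S \<subseteq> carrier H" "\<And>h. h \<in> S \<Longrightarrow> f h \<in> \<Delta> h" and xf: "x = (\<Sum>h\<in>S. f h)"
    using grading_sum[OF grH, of x] by blast
  have "\<forall>h\<in>S. \<exists>k\<in>carrier G. f h \<in> \<Gamma> k"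
    using S ref unfolding is_refinement_def by blast
  then obtain r where r: "\<And>h. h \<in> S \<Longrightarrow> r h \<in> carrier G" "\<And>h. h \<in> S \<Longrightarrow> f h \<in> \<Gamma> (r h)" by metis
  \<comment> \<open>The \<Delta>-parts of \<open>x\<close> are grouped by the component of \<Gamma>
    that contains them. \<open>?D\<close> subtracts \<open>x\<close> in degree \<open>g\<close>, so
    its values sum to 0 and independence yields \<open>?F g = x\<close>.\<close>
  let ?U = "insert g (r ` S)" and ?F = "\<lambda>k. \<Sum>h | h \<in> S \<and> r h = k. f h"
  let ?D = "\<lambda>k. ?F k - (if k = g then x else 0)"
  have U: "finite ?U" "?U \<subseteq> carrier G" using S r x by auto
  have FG: "?F k \<in> \<Gamma> k" if "k \<in> ?U" for k
    using that U r by (intro subspace_sum grading_subspace[OF gr]) auto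
  have "(\<Sum>k\<in>?U. ?F k) = x"
    unfolding xf by (rule sum.group) (use S in auto)
  then have "(\<Sum>k\<in>?U. ?D k) = 0"
    using U by (simp add: sum_subtractf sum.delta)
  moreover have "?D k \<in> \<Gamma> k" if "k \<in> ?U" for k
    using that U FG[OF that] x subspace_0 by (intro subspace_diff grading_subspace[OF gr]) (auto intro: subspace_0 grading_subspace[OF gr])
  ultimately have "?D g = 0" by (intro grading_independent[OF gr U, of ?D]) auto
  then have "?F g \<notin> W" using W by simp
  then obtain h where "h \<in> S" "r h = g" "f h \<notin> W"
    using subspace_sum[OF W(1), of "{h. h \<in> S \<and> r h = g}" f] by blast
  then show ?thesis using that[of h "f h"] S r by auto
qed

text \<open>A basis with degrees respected by the structure constants defines a grading. Components
  are described by vanishing coordinates instead of spans, so membership can be tested one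
  coordinate at a time; \<open>deg\<close> may take the same value on several basis
  elements.\<close>

lemma grading_of_coordinates:
  assumes K: "comm_group K" and I: "finite I"
    and add: "\<And>i x y. i \<in> I \<Longrightarrow> c i (x + y) = c i x + c i y"
    and scale: "\<And>i r x. i \<in> I \<Longrightarrow> c i (smul r x) = r * c i x"
    and expand: "\<And>x. (\<Sum>i\<in>I. smul (c i x) (b i)) = x"
    and dual: "\<And>i j. \<lbrakk>i \<in> I; j \<in> I\<rbrakk> \<Longrightarrow> c i (b j) = (if i = j then 1 else 0)"
    and deg: "\<And>i. i \<in> I \<Longrightarrow> deg i \<in> carrier K"
    and mul: "\<And>i j k. \<lbrakk>i \<in> I; j \<in> I; k \<in> I; c k (b i \<star> b j) \<noteq> 0\<rbrakk> \<Longrightarrow> deg k = deg i \<otimes>\<^bsub>K\<^esub> deg j"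
  shows "is_grading K (\<lambda>\<gamma>. {x. \<forall>i\<in>I. c i x \<noteq> 0 \<longrightarrow> deg i = \<gamma>})" (is "is_grading K ?V")
proof -
  have c0: "c i 0 = 0" if "i \<in> I" for i using scale[OF that, of 0 0] by simp
  have csum: "c i (\<Sum>j\<in>A. f j) = (\<Sum>j\<in>A. c i (f j))" if "i \<in> I" for i A and f :: "'k \<Rightarrow> 'a"
    by (induction A rule: infinite_finite_induct) (simp_all add: that c0 add)
  show ?thesis
  proof (rule is_gradingI[OF K])
    show "subspace (?V \<gamma>)" for \<gamma>
      unfolding subspace_def by (auto simp: c0 add scale)
    show "\<exists>S f. finite S \<and> S \<subseteq> carrier K \<and> (\<forall>\<gamma>\<in>S. f \<gamma> \<in> ?V \<gamma>) \<and> x = (\<Sum>\<gamma>\<in>S. f \<gamma>)" for x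
    proof (intro exI conjI ballI)
      let ?f = "\<lambda>\<gamma>. \<Sum>i | i \<in> I \<and> deg i = \<gamma>. smul (c i x) (b i)"
      show "?f \<gamma> \<in> ?V \<gamma>" for \<gamma>
      proof (intro CollectI ballI impI)
        fix j assume j: "j \<in> I" "c j (?f \<gamma>) \<noteq> 0"
        then obtain i where "i \<in> I" "deg i = \<gamma>" "c j (smul (c i x) (b i)) \<noteq> 0"
          by (auto simp: csum elim!: sum.not_neutral_contains_not_neutral)
        then show "deg j = \<gamma>" using j by (auto simp: scale dual split: if_splits)
      qed
      have "(\<Sum>\<gamma>\<in>deg ` I. ?f \<gamma>) = (\<Sum>i\<in>I. smul (c i x) (b i))"
        by (rule sum.group) (use I in auto)
      then show "x = (\<Sum>\<gamma>\<in>deg ` I. ?f \<gamma>)" by (simp add: expand)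
    qed (use I deg in auto)
    show "f \<gamma> = 0" if S: "finite S" "\<And>\<gamma>. \<gamma> \<in> S \<Longrightarrow> f \<gamma> \<in> ?V \<gamma>" "(\<Sum>\<gamma>\<in>S. f \<gamma>) = 0" "\<gamma> \<in> S" for S f \<gamma>
    proof -
      have "c i (f \<gamma>) = 0" if i: "i \<in> I" for i
      proof (cases "deg i = \<gamma>")
        case True
        have "0 = c i (\<Sum>\<gamma>\<in>S. f \<gamma>)" using S c0 i by simp
        also have "\<dots> = (\<Sum>\<gamma>\<in>S. c i (f \<gamma>))" by (rule csum[OF i])
        \<comment> \<open>The coordinate \<open>i\<close> belongs to degree \<gamma>, so it vanishes
          on every summand of another degree.\<close>
        also have "\<dots> = (\<Sum>\<gamma>'\<in>{\<gamma>}. c i (f \<gamma>'))"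
          by (rule sum.mono_neutral_right) (use S i True in fastforce)+
        finally show ?thesis by simp
      qed (use S i in auto)
      then show ?thesis using expand[of "f \<gamma>"] by simp
    qed
    show "x \<star> y \<in> ?V (\<gamma> \<otimes>\<^bsub>K\<^esub> \<gamma>')" if x: "x \<in> ?V \<gamma>" and y: "y \<in> ?V \<gamma>'" for x y \<gamma> \<gamma>'
    proof (intro CollectI ballI impI)
      fix k assume k: "k \<in> I" "c k (x \<star> y) \<noteq> 0"
      have "c k (x \<star> y) = c k ((\<Sum>i\<in>I. smul (c i x) (b i)) \<star> (\<Sum>j\<in>I. smul (c j y) (b j)))"
        by (simp add: expand)
      also have "\<dots> = (\<Sum>i\<in>I. \<Sum>j\<in>I. c i x * (c j y * c k (b i \<star> b j)))"
        by (subst mul_sum_left) (simp add: mul_sum_right mul_scale_left mul_scale_right csum scale k sum_distrib_left mult_ac)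
      finally obtain i j where ij: "i \<in> I" "j \<in> I" "c i x * (c j y * c k (b i \<star> b j)) \<noteq> 0"
        using k(2) by (metis (no_types, lifting) sum.not_neutral_contains_not_neutral)
      then show "deg k = \<gamma> \<otimes>\<^bsub>K\<^esub> \<gamma>'" using mul[OF ij(1,2) k(1)] x y by simp
    qed
  qed
qed

end

text \<open>By linearity of the involution it suffices to compare degrees on basis elements.\<close>

lemma (in involution_algebra) inv_grading_of_coordinates:
  assumes gr: "is_grading K (\<lambda>\<gamma>. {x. \<forall>i\<in>I. c i x \<noteq> 0 \<longrightarrow> deg i = \<gamma>})"
    and add: "\<And>i x y. i \<in> I \<Longrightarrow> c i (x + y) = c i x + c i y"
    and scale: "\<And>i r x. i \<in> I \<Longrightarrow> c i (smul r x) = r * c i x"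
    and expand: "\<And>x. (\<Sum>i\<in>I. smul (c i x) (b i)) = x"
    and inv: "\<And>i k. \<lbrakk>i \<in> I; k \<in> I; c k (\<sigma> (b i)) \<noteq> 0\<rbrakk> \<Longrightarrow> deg k = deg i"
  shows "is_inv_grading K (\<lambda>\<gamma>. {x. \<forall>i\<in>I. c i x \<noteq> 0 \<longrightarrow> deg i = \<gamma>})" (is "is_inv_grading K ?V")
proof -
  have c0: "c i 0 = 0" if "i \<in> I" for i using scale[OF that, of 0 0] by simp
  have csum: "c i (\<Sum>j\<in>A. f j) = (\<Sum>j\<in>A. c i (f j))" if "i \<in> I" for i A and f :: "'k \<Rightarrow> 'a"
    by (induction A rule: infinite_finite_induct) (simp_all add: that c0 add)
  have \<sigma>0: "\<sigma> 0 = 0" using inv_scale[of 0 0] by simp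
  have \<sigma>sum: "\<sigma> (\<Sum>j\<in>A. f j) = (\<Sum>j\<in>A. \<sigma> (f j))" for A and f :: "'k \<Rightarrow> 'a"
    by (induction A rule: infinite_finite_induct) (simp_all add: \<sigma>0 inv_add)
  have "\<sigma> x \<in> ?V \<gamma>" if x: "x \<in> ?V \<gamma>" for x \<gamma>
  proof (intro CollectI ballI impI)
    fix k assume k: "k \<in> I" "c k (\<sigma> x) \<noteq> 0"
    have "c k (\<sigma> x) = c k (\<sigma> (\<Sum>i\<in>I. smul (c i x) (b i)))" by (simp add: expand)
    also have "\<dots> = (\<Sum>i\<in>I. c i x * c k (\<sigma> (b i)))"
      by (simp add: \<sigma>sum csum scale inv_scale k)
    finally obtain i where "i \<in> I" "c i x * c k (\<sigma> (b i)) \<noteq> 0"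
      using k(2) by (metis (no_types, lifting) sum.not_neutral_contains_not_neutral)
    then show "deg k = \<gamma>" using inv k x by auto
  qed
  then show ?thesis using gr by (auto simp: is_inv_grading_def)
qed


text \<open>The eigenspaces of an involutive automorphism split the components of a grading.\<close>

lemma (in involution_algebra) involutive_automorphism_refinement:
  fixes K :: "('k, 'y) monoid_scheme"
  assumes gr: "is_inv_grading K V" and char: "(1::'f) \<noteq> -1"
    and add: "\<And>x y. \<psi> (x + y) = \<psi> x + \<psi> y" and scale: "\<And>r x. \<psi> (smul r x) = smul r (\<psi> x)"
    and mul: "\<And>x y. \<psi> (x \<star> y) = \<psi> x \<star> \<psi> y" and inv: "\<And>x. \<psi> (\<sigma> x) = \<sigma> (\<psi> x)"
    and invol: "\<And>x. \<psi> (\<psi> x) = x"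
    and pres: "\<And>\<gamma> x. \<gamma> \<in> carrier K \<Longrightarrow> x \<in> V \<gamma> \<Longrightarrow> \<psi> x \<in> V \<gamma>"
    and x0: "\<gamma>\<^sub>0 \<in> carrier K" "x\<^sub>0 \<in> V \<gamma>\<^sub>0" "\<psi> x\<^sub>0 \<noteq> x\<^sub>0" "\<psi> x\<^sub>0 \<noteq> - x\<^sub>0"
  shows "\<exists>(H :: ('k \<times> 'f) monoid) \<Delta>. is_inv_grading H \<Delta> \<and> is_proper_refinement H \<Delta> K V"
proof -
  \<comment> \<open>The eigenvalue is recorded as a second coordinate of the degree. Eigenvalues
    multiply because \<psi> is multiplicative, so this coordinate lives in the group of
    signs.\<close>
  define Z :: "'f monoid" where "Z = \<lparr>carrier = {1, -1}, monoid.mult = (*), one = 1\<rparr>"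
  define H where "H = K \<times>\<times> Z"
  define \<Delta> where "\<Delta> = (\<lambda>(\<gamma>, \<epsilon>). {x \<in> V \<gamma>. \<psi> x = smul \<epsilon> x})"
  have grK: "is_grading K V" using gr by (simp add: is_inv_grading_def)
  interpret K: comm_group K using grK by (simp add: is_grading_def)
  have Z: "comm_group Z" by (rule comm_groupI) (auto simp: Z_def)
  have ZC: "carrier Z = {1, -1}" by (simp add: Z_def)
  have H: "comm_group H"
  proof (rule group.group_comm_groupI)
    show "group H" unfolding H_def using Z by (intro DirProd_group K.is_group) (simp add: comm_group_def)
    show "x \<otimes>\<^bsub>H\<^esub> y = y \<otimes>\<^bsub>H\<^esub> x" if "x \<in> carrier H" "y \<in> carrier H" for x y
      using that by (auto simp: H_def K.m_comm Z_def)
  qed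
  have carH: "carrier H = carrier K \<times> {1, -1}" by (simp add: H_def ZC)
  have two: "(1::'f) + 1 \<noteq> 0" using char by (metis add_eq_0_iff minus_equation_iff)
  have sub: "subspace (V \<gamma>)" if "\<gamma> \<in> carrier K" for \<gamma> using grK that by (rule grading_subspace)
  have \<psi>0: "\<psi> 0 = 0" using scale[of 0 0] by simp
  have dbl: "x = 0" if "x + x = 0" for x :: 'a
  proof -
    have "smul (1 + 1) x = 0" using that by (simp only: scale_left_distrib scale_one)
    then show ?thesis using two by simp
  qed
  have "is_grading H \<Delta>"
  proof (rule is_gradingI[OF H])
    show "subspace (\<Delta> g)" if "g \<in> carrier H" for g
      using that sub unfolding subspace_def carH \<Delta>_def
      by (auto simp: \<psi>0 add scale scale_right_distrib mult.commute)
  next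
    fix a
    obtain S f where S: "finite S" "S \<subseteq> carrier K" "\<And>\<gamma>. \<gamma> \<in> S \<Longrightarrow> f \<gamma> \<in> V \<gamma>" and a: "a = (\<Sum>\<gamma>\<in>S. f \<gamma>)"
      using grading_sum[OF grK, of a] by blast
    \<comment> \<open>These are the projections of \<open>f \<gamma>\<close> onto the two
      eigenspaces of \<psi>; halving is possible because 1 and -1 differ.\<close>
    define F where "F = (\<lambda>(\<gamma>, \<epsilon>). smul (1 / (1 + 1)) (f \<gamma> + smul \<epsilon> (\<psi> (f \<gamma>))))"
    have mem: "F g \<in> \<Delta> g" if "g \<in> S \<times> {1, -1}" for g
    proof -
      obtain \<gamma> \<epsilon> where g: "g = (\<gamma>, \<epsilon>)" "\<gamma> \<in> S" "\<epsilon> * \<epsilon> = 1" using \<open>g \<in> _\<close> by auto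
      then have "F g \<in> V \<gamma>" using S pres[of \<gamma> "f \<gamma>"] sub[of \<gamma>]
        unfolding F_def by (auto intro!: subspace_scale subspace_add)
      moreover have "\<psi> (F g) = smul \<epsilon> (F g)"
        using g(3) by (simp add: g F_def scale add invol scale_right_distrib mult.commute add.commute mult.assoc)
      ultimately show ?thesis by (simp add: \<Delta>_def g)
    qed
    have half: "F (\<gamma>, 1) + F (\<gamma>, -1) = f \<gamma>" for \<gamma>
    proof -
      have "F (\<gamma>, 1) + F (\<gamma>, -1) = smul (1 / (1 + 1)) (smul (1 + 1) (f \<gamma>))"
        unfolding F_def by (simp only: prod.case scale_right_distrib[symmetric] scale_left_distrib) simp
      also have "\<dots> = f \<gamma>" using two by simp
      finally show ?thesis .
    qed
    have "(\<Sum>g\<in>S \<times> {1, -1}. F g) = (\<Sum>\<gamma>\<in>S. \<Sum>\<epsilon>\<in>{1, -1}. F (\<gamma>, \<epsilon>))"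
      by (simp only: sum.cartesian_product case_prod_unfold prod.collapse)
    also have "\<dots> = (\<Sum>\<gamma>\<in>S. f \<gamma>)"
      using char by (intro sum.cong) (simp_all add: half)
    finally show "\<exists>S f. finite S \<and> S \<subseteq> carrier H \<and> (\<forall>g\<in>S. f g \<in> \<Delta> g) \<and> a = (\<Sum>g\<in>S. f g)"
      using S mem a by (intro exI[of _ "S \<times> {1, -1}"] exI[of _ F]) (auto simp: carH)
  next
    fix S f g
    assume S: "finite S" "S \<subseteq> carrier H" "\<And>g. g \<in> S \<Longrightarrow> f g \<in> \<Delta> g" "(\<Sum>g\<in>S. f g) = 0" "g \<in> S"
    \<comment> \<open>Extension by zero completes the sum over \<open>S\<close> to all pairs of a
      degree and a sign, so that the two signs can be added degree by degree.\<close>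
    define F where "F g = (if g \<in> S then f g else 0)" for g
    let ?U = "fst ` S"
    have U: "finite ?U" "?U \<subseteq> carrier K" using S by (auto simp: carH)
    have FV: "F (\<gamma>, \<epsilon>) \<in> V \<gamma>" if "\<gamma> \<in> ?U" for \<gamma> \<epsilon>
      using S(3)[of "(\<gamma>, \<epsilon>)"] U that subspace_0[OF sub] by (auto simp: F_def \<Delta>_def)
    have F\<psi>: "\<psi> (F (\<gamma>, \<epsilon>)) = smul \<epsilon> (F (\<gamma>, \<epsilon>))" for \<gamma> \<epsilon>
      using S(3)[of "(\<gamma>, \<epsilon>)"] by (auto simp: F_def \<Delta>_def \<psi>0)
    have "(\<Sum>\<gamma>\<in>?U. F (\<gamma>, 1) + F (\<gamma>, -1)) = (\<Sum>\<gamma>\<in>?U. \<Sum>\<epsilon>\<in>{1, -1}. F (\<gamma>, \<epsilon>))"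
      using char by simp
    also have "\<dots> = (\<Sum>g\<in>?U \<times> {1, -1}. F g)"
      by (simp only: sum.cartesian_product case_prod_unfold prod.collapse)
    also have "\<dots> = (\<Sum>g\<in>S. f g)"
    proof (rule sum.mono_neutral_cong_right)
      show "S \<subseteq> ?U \<times> {1, -1}"
      proof
        fix h assume h: "h \<in> S"
        then show "h \<in> ?U \<times> {1, -1}" using S(2) by (cases h) (auto simp: carH intro: image_eqI[OF _ h])
      qed
      show "finite (?U \<times> {1, -1 :: 'f})" using U by simp
      show "\<forall>g\<in>?U \<times> {1, -1} - S. F g = 0" "\<And>g. g \<in> S \<Longrightarrow> F g = f g" by (simp_all add: F_def)
    qed
    finally have 0: "(\<Sum>\<gamma>\<in>?U. F (\<gamma>, 1) + F (\<gamma>, -1)) = 0" using S by simp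
    obtain \<gamma> \<epsilon> where g: "g = (\<gamma>, \<epsilon>)" by (cases g)
    have g': "\<epsilon> \<in> {1, -1}" "\<gamma> \<in> ?U" using S(2,5) image_eqI[of \<gamma> fst g S] by (auto simp: carH g)
    have e: "F (\<gamma>, 1) + F (\<gamma>, -1) = 0"
      by (rule grading_independent[OF grK U _ 0 g'(2)]) (use FV U sub in \<open>blast intro: subspace_add\<close>)
    \<comment> \<open>Applying \<psi> turns the vanishing sum of the two eigenvectors into a
      vanishing difference; hence each is zero, as 2 is invertible.\<close>
    then have "\<psi> (F (\<gamma>, 1) + F (\<gamma>, -1)) = 0" by (simp add: \<psi>0)
    then have "F (\<gamma>, 1) = F (\<gamma>, -1)" by (simp add: add F\<psi>)
    then have "F (\<gamma>, 1) = 0" "F (\<gamma>, -1) = 0" using e dbl[of "F (\<gamma>, -1)"] by simp_all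
    then have "F g = 0" using g g' by auto
    then show "f g = 0" using S(5) by (simp add: F_def)
  next
    fix g h x y assume *: "g \<in> carrier H" "h \<in> carrier H" "x \<in> \<Delta> g" "y \<in> \<Delta> h"
    obtain \<gamma> \<epsilon> \<gamma>' \<epsilon>' where gh: "g = (\<gamma>, \<epsilon>)" "h = (\<gamma>', \<epsilon>')" by (cases g, cases h)
    have "\<psi> (x \<star> y) = smul (\<epsilon> * \<epsilon>') (x \<star> y)"
      using * by (simp add: gh \<Delta>_def mul mul_scale_left mul_scale_right)
    moreover have "g \<otimes>\<^bsub>H\<^esub> h = (\<gamma> \<otimes>\<^bsub>K\<^esub> \<gamma>', \<epsilon> * \<epsilon>')" by (simp add: gh H_def Z_def)
    ultimately show "x \<star> y \<in> \<Delta> (g \<otimes>\<^bsub>H\<^esub> h)"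
      using * grading_mul[OF grK, of \<gamma> \<gamma>' x y] by (auto simp: gh carH \<Delta>_def)
  qed
  moreover have "\<sigma> (- x) = - \<sigma> x" for x using inv_scale[of "-1" x] by simp
  ultimately have "is_inv_grading H \<Delta>"
    using gr unfolding is_inv_grading_def 
    by (auto simp: carH \<Delta>_def inv inv_scale)
  moreover have "is_proper_refinement H \<Delta> K V"
    unfolding is_proper_refinement_def is_refinement_def
  proof
    show "\<forall>h\<in>carrier H. \<exists>g\<in>carrier K. \<Delta> h \<subseteq> V g" by (auto simp: carH \<Delta>_def)
    \<comment> \<open>The two inequalities for \<open>x\<^sub>0\<close> serve different ends: one
      makes this eigenvector nonzero, the other keeps \<open>x\<^sub>0\<close> itself out of the
      smaller component.\<close>
    have "x\<^sub>0 + \<psi> x\<^sub>0 \<in> \<Delta> (\<gamma>\<^sub>0, 1)" "x\<^sub>0 + \<psi> x\<^sub>0 \<noteq> 0" "x\<^sub>0 \<notin> \<Delta> (\<gamma>\<^sub>0, 1)" "\<Delta> (\<gamma>\<^sub>0, 1) \<subseteq> V \<gamma>\<^sub>0"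
      using x0 pres[OF x0(1,2)] sub[OF x0(1)]
      by (auto simp: \<Delta>_def add invol add.commute add_eq_0_iff intro: subspace_add)
    then show "\<exists>h\<in>carrier H. \<exists>g\<in>carrier K. \<Delta> h \<noteq> {0} \<and> \<Delta> h \<subset> V g"
      using x0(1,2) by (intro bexI[of _ "(\<gamma>\<^sub>0, 1)"] bexI[of _ \<gamma>\<^sub>0]) (auto simp: carH)
  qed
  ultimately show ?thesis by blast
qed


section \<open>Graded-division algebras with one-dimensional components\<close>

locale graded_division_involution = involution_algebra smul "(*)" 1 \<phi>\<^sub>0
  for smul :: "'f::field \<Rightarrow> 'd::ring_1 \<Rightarrow> 'd" and \<phi>\<^sub>0 :: "'d \<Rightarrow> 'd" +
  fixes G :: "('g, 'z) monoid_scheme" and \<Gamma> :: "'g \<Rightarrow> 'd set"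
  assumes finite_dim: finite_dim
    and division: "is_division_grading G \<Gamma>"
    and one_dim: "one_dim_components G \<Gamma>"
    and inv_grading: "is_inv_grading G \<Gamma>"
begin

abbreviation T :: "'g set" where "T \<equiv> grading_support G \<Gamma>"

lemma grading: "is_grading G \<Gamma>"
  using division by (simp add: is_division_grading_def)

sublocale G: comm_group G
  using grading by (simp add: is_grading_def)

lemma T_carrier: "s \<in> T \<Longrightarrow> s \<in> carrier G"
  by (simp add: grading_support_def)

lemma in_T: "s \<in> carrier G \<Longrightarrow> x \<in> \<Gamma> s \<Longrightarrow> x \<noteq> 0 \<Longrightarrow> s \<in> T"
  by (auto simp: grading_support_def)

lemma T_nonzero:
  assumes "s \<in> T"
  obtains x where "x \<in> \<Gamma> s" "x \<noteq> 0"
  using assms subspace_0[OF grading_subspace[OF grading]] by (auto simp: grading_support_def)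

lemma invertible:
  assumes "s \<in> carrier G" "x \<in> \<Gamma> s" "x \<noteq> 0"
  obtains y where "x * y = 1" "y * x = 1"
  using assms division unfolding is_division_grading_def nonzero_homogeneous_def by blast

lemma mult_nonzero:
  assumes "s \<in> carrier G" "x \<in> \<Gamma> s" "x \<noteq> 0" "y \<noteq> 0"
  shows "x * y \<noteq> 0"
proof
  assume "x * y = 0"
  obtain x' where "x' * x = 1" using invertible[OF assms(1-3)] by metis
  then have "y = x' * (x * y)" by (simp add: mult.assoc[symmetric])
  then show False using \<open>x * y = 0\<close> assms by simp
qed

lemma component_line:
  assumes "s \<in> carrier G" "x \<in> \<Gamma> s" "x \<noteq> 0" "y \<in> \<Gamma> s"
  obtains c where "y = smul c x"
proof -
  have "dim (\<Gamma> s) = 1" using one_dim in_T assms by (auto simp: one_dim_components_def)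
  then obtain b where b: "\<Gamma> s \<subseteq> span {b}"
    using basis_exists[of "\<Gamma> s"] by (metis card_1_singletonE)
  then obtain p q where p: "x = smul p b" and q: "y = smul q b"
    using assms unfolding span_singleton by blast
  then have "y = smul (q / p) x" using assms by auto
  then show ?thesis by (rule that)
qed

lemma one_mem: "1 \<in> \<Gamma> \<one>\<^bsub>G\<^esub>"
  by (rule unit_homogeneous[OF grading])

lemma one_T: "\<one>\<^bsub>G\<^esub> \<in> T"
  using in_T[OF G.one_closed one_mem] by simp

lemma T_mult: "s \<in> T \<Longrightarrow> t \<in> T \<Longrightarrow> s \<otimes>\<^bsub>G\<^esub> t \<in> T"
proof -
  assume st: "s \<in> T" "t \<in> T"
  obtain x where "x \<in> \<Gamma> s" "x \<noteq> 0" by (rule T_nonzero[OF st(1)])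
  moreover obtain y where "y \<in> \<Gamma> t" "y \<noteq> 0" by (rule T_nonzero[OF st(2)])
  ultimately show ?thesis using st T_carrier grading_mul[OF grading, of s t x y] mult_nonzero[of s x y]
    by (intro in_T[of _ "x * y"]) auto
qed

lemma finite_T: "finite T"
  by (rule finite_support[OF finite_dim grading])

text \<open>The division property gives an inverse without telling its degree. Translation by
  \<open>s\<close> is an injection of the finite set \<open>T\<close> into itself, hence reaches the
  neutral element; a suitable multiple of an element of the degree found is a right inverse, and so
  it is the inverse.\<close>

lemma inverse:
  assumes x: "s \<in> carrier G" "x \<in> \<Gamma> s" "x \<noteq> 0"
  shows "inv\<^bsub>G\<^esub> s \<in> T" and "\<exists>y\<in>\<Gamma> (inv\<^bsub>G\<^esub> s). x * y = 1 \<and> y * x = 1"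
proof -
  have s: "s \<in> T" using x by (rule in_T)
  have "inj_on (\<lambda>t. s \<otimes>\<^bsub>G\<^esub> t) T" using x T_carrier by (auto intro!: inj_onI)
  moreover have "(\<lambda>t. s \<otimes>\<^bsub>G\<^esub> t) ` T \<subseteq> T" using T_mult s by blast
  ultimately have "(\<lambda>t. s \<otimes>\<^bsub>G\<^esub> t) ` T = T" by (rule endo_inj_surj[OF finite_T, rotated])
  then obtain t where t: "t \<in> T" "s \<otimes>\<^bsub>G\<^esub> t = \<one>\<^bsub>G\<^esub>" using one_T by (metis imageE)
  have ti: "inv\<^bsub>G\<^esub> s = t" using t x T_carrier by (metis G.inv_equality G.m_comm)
  then show "inv\<^bsub>G\<^esub> s \<in> T" using t by simp
  obtain z where z: "z \<in> \<Gamma> t" "z \<noteq> 0" by (rule T_nonzero[OF t(1)])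
  have "x * z \<in> \<Gamma> \<one>\<^bsub>G\<^esub>" using grading_mul[OF grading x(1) T_carrier[OF t(1)] x(2) z(1)] t(2) by simp
  then obtain c where "1 = smul c (x * z)"
    using component_line[of "\<one>\<^bsub>G\<^esub>" "x * z" 1] one_mem mult_nonzero[OF x z(2)] by auto
  then have "x * smul c z = 1" by (simp add: mul_scale_right)
  moreover obtain y where y: "x * y = 1" "y * x = 1" by (rule invertible[OF x])
  ultimately have "y = smul c z" by (metis mult.assoc mult_1 mult_1_right)
  moreover have "smul c z \<in> \<Gamma> t" using z grading_subspace[OF grading T_carrier[OF t(1)]] by (simp add: subspace_scale)
  ultimately show "\<exists>y\<in>\<Gamma> (inv\<^bsub>G\<^esub> s). x * y = 1 \<and> y * x = 1" using y ti by auto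
qed

lemma T_subgroup: "subgroup T G"
proof (rule G.subgroupI)
  show "T \<noteq> {}" using one_T by auto
  show "inv\<^bsub>G\<^esub> s \<in> T" if s: "s \<in> T" for s
  proof -
    obtain x where "x \<in> \<Gamma> s" "x \<noteq> 0" using s by (rule T_nonzero)
    then show ?thesis using inverse(1) T_carrier s by blast
  qed
qed (auto simp: T_carrier T_mult)

lemma hom_degree_eq: "s \<in> carrier G \<Longrightarrow> x \<in> \<Gamma> s \<Longrightarrow> x \<noteq> 0 \<Longrightarrow> hom_degree G \<Gamma> x = s"
  unfolding hom_degree_def using component_disjoint[OF grading] by blast

section \<open>A homogeneous basis of D indexed by the support\<close>

definition bas :: "'g \<Rightarrow> 'd" where "bas s = (SOME x. x \<in> \<Gamma> s \<and> x \<noteq> 0)"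

definition coef :: "'g \<Rightarrow> 'd \<Rightarrow> 'f" where "coef s a = representation (bas ` T) a (bas s)"

lemma bas: assumes "s \<in> T" shows "bas s \<in> \<Gamma> s" "bas s \<noteq> 0"
proof -
  have "\<exists>x. x \<in> \<Gamma> s \<and> x \<noteq> 0" using T_nonzero[OF assms] by blast
  from someI_ex[OF this] show "bas s \<in> \<Gamma> s" "bas s \<noteq> 0" by (auto simp: bas_def)
qed

lemma inj_bas: "inj_on bas T"
  by (rule inj_onI) (metis bas T_carrier component_disjoint[OF grading])

lemma independent_bas: "independent (bas ` T)"
proof
  assume "dependent (bas ` T)"
  then obtain u v where u: "v \<in> bas ` T" "u v \<noteq> 0" "(\<Sum>v\<in>bas ` T. smul (u v) v) = 0"
    using finite_T by (auto simp: dependent_finite)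
  then have 0: "(\<Sum>s\<in>T. smul (u (bas s)) (bas s)) = 0" by (simp add: sum.reindex[OF inj_bas])
  obtain s where s: "s \<in> T" "v = bas s" using u by blast
  have "smul (u (bas s)) (bas s) = 0"
    by (rule grading_independent[OF grading finite_T _ _ 0 s(1)])
      (auto simp: T_carrier bas intro!: subspace_scale grading_subspace[OF grading])
  then show False using u s bas by simp
qed

lemma span_bas: "a \<in> span (bas ` T)"
proof -
  obtain S f where S: "finite S" "S \<subseteq> carrier G" "\<And>g. g \<in> S \<Longrightarrow> f g \<in> \<Gamma> g" and a: "a = (\<Sum>g\<in>S. f g)"
    using grading_sum[OF grading, of a] by blast
  have "f g \<in> span (bas ` T)" if g: "g \<in> S" for g
  proof (cases "f g = 0")
    case False
    then have gT: "g \<in> T" using in_T S g by blast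
    obtain c where "f g = smul c (bas g)"
      by (rule component_line[OF T_carrier[OF gT] bas[OF gT] S(3)[OF g]])
    then show ?thesis using gT by (simp add: span_base span_scale)
  qed (simp add: span_zero)
  then show ?thesis unfolding a by (intro span_sum) auto
qed

lemma coef_add: "coef s (a + b) = coef s a + coef s b"
  by (simp add: coef_def representation_add independent_bas span_bas)

lemma coef_scale: "coef s (smul r a) = r * coef s a"
  by (simp add: coef_def representation_scale independent_bas span_bas)

lemma coef_0 [simp]: "coef s 0 = 0"
  using coef_scale[of s 0 0] by simp

lemma coef_expand: "(\<Sum>s\<in>T. smul (coef s a) (bas s)) = a"
  using sum_representation_eq[OF independent_bas span_bas, of "bas ` T" a] finite_T
  by (simp add: sum.reindex[OF inj_bas] coef_def)

lemma coef_bas: "s \<in> T \<Longrightarrow> t \<in> T \<Longrightarrow> coef s (bas t) = (if s = t then 1 else 0)"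
  using inj_onD[OF inj_bas, of s t] by (auto simp: coef_def representation_basis independent_bas)

lemma coef_nonzero:
  assumes "x \<in> \<Gamma> s" "s \<in> carrier G" "r \<in> T" "coef r x \<noteq> 0"
  shows "r = s"
proof -
  have "x \<noteq> 0" using assms by auto
  then have s: "s \<in> T" using in_T assms by blast
  obtain c where "x = smul c (bas s)" by (rule component_line[OF T_carrier[OF s] bas[OF s] assms(1)])
  then show ?thesis using assms s by (simp add: coef_scale coef_bas split: if_splits)
qed

lemma coef_ext: "(\<And>s. s \<in> T \<Longrightarrow> coef s a = coef s b) \<Longrightarrow> a = b"
  using coef_expand[of a] coef_expand[of b] by (metis (no_types, lifting) sum.cong)

lemma \<phi>\<^sub>0_zero: "\<phi>\<^sub>0 0 = 0"
  using inv_scale[of 0 0] by simp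

lemma \<phi>\<^sub>0_one: "\<phi>\<^sub>0 1 = 1"
  by (metis inv_inv inv_mul mult.left_neutral mult.right_neutral)

lemma \<phi>\<^sub>0_mem: "s \<in> carrier G \<Longrightarrow> x \<in> \<Gamma> s \<Longrightarrow> \<phi>\<^sub>0 x \<in> \<Gamma> s"
  using inv_grading by (auto simp: is_inv_grading_def)

lemma scale_left_cancel_unit: "x \<noteq> 0 \<Longrightarrow> smul c x = x \<Longrightarrow> c = 1"
  by (metis scale_one scale_right_imp_eq)

text \<open>The involution maps the line through \<open>x\<close> to itself, so \<open>x\<close> is
  an eigenvector, and applying the involution twice shows that the eigenvalue squares to 1.\<close>

lemma \<phi>\<^sub>0_sign:
  assumes x: "s \<in> carrier G" "x \<in> \<Gamma> s"
  obtains \<eta> where "\<phi>\<^sub>0 x = smul \<eta> x" "\<eta> * \<eta> = 1"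
proof (cases "x = 0")
  case True
  then show ?thesis using that[of 1] \<phi>\<^sub>0_zero by simp
next
  case False
  obtain \<eta> where \<eta>: "\<phi>\<^sub>0 x = smul \<eta> x" by (rule component_line[OF x(1,2) False \<phi>\<^sub>0_mem[OF x]])
  then have "smul (\<eta> * \<eta>) x = x" using inv_inv[of x] by (simp add: inv_scale)
  then show ?thesis using \<eta> that scale_left_cancel_unit[OF False] by blast
qed

end


section \<open>Degrees in \<open>\<tilde>G(T,2,0,(t\<^sub>1,t\<^sub>2))\<close>\<close>

text \<open>This is the class of \<open>g_i g_j^-1 s\<close> as a single coset, with the free factor
  written additively; \<open>degree_eq_gen\<close> identifies it with the product formed in the
  quotient group.\<close>

definition tilde_degree :: "('g, 'z) monoid_scheme \<Rightarrow> (2 \<Rightarrow> 'g) \<Rightarrow> 2 \<Rightarrow> 2 \<Rightarrow> 'g \<Rightarrow> ('g \<times> (2 \<Rightarrow>\<^sub>0 int)) set" where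
  "tilde_degree T t i j s = tilde_relations T t #>\<^bsub>tilde_base T\<^esub> (s, frag_of i - frag_of j)"

locale tilde = T: comm_group T for T :: "('g, 'z) monoid_scheme" (structure) +
  fixes t :: "2 \<Rightarrow> 'g"
  assumes t [simp]: "t i \<in> carrier T"
begin

abbreviation "B \<equiv> tilde_base T"

lemma base_group: "comm_group B"
proof (rule group.group_comm_groupI)
  show "group B" by (intro DirProd_group T.is_group group_free_Abelian_group)
  show "x \<otimes>\<^bsub>B\<^esub> y = y \<otimes>\<^bsub>B\<^esub> x" if "x \<in> carrier B" "y \<in> carrier B" for x y
    using that by (cases x; cases y) (simp add: T.m_comm add.commute)
qed

sublocale B: comm_group B by (rule base_group)

lemma base_inv: "s \<in> carrier T \<Longrightarrow> inv\<^bsub>B\<^esub> (s, c) = (inv s, - c)"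
  by (rule B.inv_equality) auto

lemma frag_cmul_2: "frag_cmul 2 c = c + c"
  using frag_cmul_distrib[of 1 1 c] by simp

text \<open>The relation \<open>g_1^2 t_1^-1 = g_2^2 t_2^-1\<close> brought to one side, additive in
  the free factor.\<close>

definition relator :: "'g \<times> (2 \<Rightarrow>\<^sub>0 int)" where
  "relator = (inv (t 1) \<otimes> t 2, frag_cmul 2 (frag_of 1) - frag_cmul 2 (frag_of 2))"

lemma relations_eq: "tilde_relations T t = generate B {relator}"
proof -
  have pow: "x [^]\<^bsub>B\<^esub> (2::nat) = x \<otimes>\<^bsub>B\<^esub> x" if "x \<in> carrier B" for x
    using B.l_one[OF that] by (simp only: numeral_2_eq_2 B.nat_pow_Suc B.nat_pow_0)
  have side: "tilde_side T t i = (inv (t i), frag_cmul 2 (frag_of i))" for i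
    by (simp add: tilde_side_def pow base_inv frag_cmul_2 del: mult_2)
  have "tilde_side T t 1 \<otimes>\<^bsub>B\<^esub> inv\<^bsub>B\<^esub> tilde_side T t 2 = relator"
    by (simp add: side relator_def base_inv)
  then show ?thesis unfolding tilde_relations_def by simp
qed

lemma relator_carrier: "relator \<in> carrier B"
  by (simp add: relator_def)

lemma relations_normal: "tilde_relations T t \<lhd> B"
  unfolding relations_eq using relator_carrier by (intro B.subgroup_imp_normal B.generate_is_subgroup) auto

sublocale N: normal "tilde_relations T t" B by (rule relations_normal)

text \<open>The subgroup of relations is cyclic, so its elements are the powers of
  \<open>relator\<close>. Two consequences matter: a relation with zero free part is trivial, so
  \<open>T\<close> embeds, and all free exponents of a relation are even.\<close>

lemma in_relations:
  assumes "x \<in> tilde_relations T t"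
  obtains n :: int where "fst x = (inv (t 1) \<otimes> t 2) [^] n"
    "\<And>i. Poly_Mapping.lookup (snd x) i = (if i = 1 then 2 * n else - 2 * n)"
proof -
  let ?P = "\<lambda>x (n::int). fst x = (inv (t 1) \<otimes> t 2) [^] n \<and>
    (\<forall>i. Poly_Mapping.lookup (snd x) i = (if i = 1 then 2 * n else - 2 * n))"
  have 1: "?P relator 1"
    by (auto simp: relator_def lookup_add lookup_minus forall_2)
  have "\<exists>n. ?P x n" using assms unfolding relations_eq
  proof induction
    case one
    then show ?case by (intro exI[of _ 0]) (simp add: one_DirProd)
  next
    case (incl h)
    then show ?case using 1 by blast
  next
    case (inv h)
    moreover have "inv\<^bsub>B\<^esub> relator = (inv (fst relator), - snd relator)"
      using base_inv[of "fst relator" "snd relator"] by (simp add: relator_def)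
    ultimately show ?case using 1 by (intro exI[of _ "-1"]) (auto simp: T.int_pow_neg)
  next
    case (eng h1 h2)
    then obtain m n where "?P h1 m" "?P h2 n" by blast
    then show ?case by (intro exI[of _ "m + n"]) (auto simp: mult_DirProd' lookup_add T.int_pow_mult)
  qed
  then show ?thesis using that by blast
qed

lemma degree_eq_iff:
  assumes "s \<in> carrier T" "r \<in> carrier T"
  shows "tilde_degree T t i j s = tilde_degree T t k l r \<longleftrightarrow>
    (s \<otimes> inv r, frag_of i - frag_of j - (frag_of k - frag_of l)) \<in> tilde_relations T t" (is "?L \<longleftrightarrow> ?R")
proof -
  let ?x = "(s, frag_of i - frag_of j)" and ?y = "(r, frag_of k - frag_of l)"
  have "?x \<otimes>\<^bsub>B\<^esub> inv\<^bsub>B\<^esub> ?y = (s \<otimes> inv r, frag_of i - frag_of j - (frag_of k - frag_of l))"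
    using assms by (simp add: base_inv)
  then have "?R \<longleftrightarrow> ?x \<in> tilde_relations T t #>\<^bsub>B\<^esub> ?y"
    using N.rcos_module[OF B.is_group, of ?y ?x] assms by (simp del: mult_DirProd)
  also have "\<dots> \<longleftrightarrow> ?L" unfolding tilde_degree_def
    using B.repr_independence[OF _ _ N.subgroup_axioms, of ?x ?y] assms
      B.repr_independenceD[OF N.subgroup_axioms, of ?x ?y] by (auto dest: sym)
  finally show ?thesis by blast
qed

lemma conjugate_cancel:
  assumes "a \<in> carrier T" "b \<in> carrier T" "s \<in> carrier T"
  shows "inv a \<otimes> s \<otimes> b \<otimes> inv s = inv a \<otimes> b"
proof -
  have "inv a \<otimes> s \<otimes> b \<otimes> inv s = inv a \<otimes> (b \<otimes> s) \<otimes> inv s"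
    using assms by (simp add: T.m_assoc T.m_comm[of s b])
  also have "\<dots> = inv a \<otimes> b"
    using assms by (simp add: T.m_assoc)
  finally show ?thesis .
qed

text \<open>The defining relation can be rewritten as
  \<open>g_i g_j^-1 = g_j g_i^-1 t_j^-1 t_i\<close>. This is the identity that makes the involution
  of the matrix algebra preserve degrees, since it sends the position \<open>(i, j)\<close> to
  \<open>(j, i)\<close> and conjugates with the entries of the diagonal matrix.\<close>

lemma degree_swap:
  assumes s: "s \<in> carrier T"
  shows "tilde_degree T t j i (inv (t j) \<otimes> s \<otimes> t i) = tilde_degree T t i j s"
proof -
  consider "i = j" | "i = 1" "j = 2" | "i = 2" "j = 1" using exhaust_2[of i] exhaust_2[of j] by auto
  then show ?thesis
  proof cases
    case 1
    have "inv (t j) \<otimes> s \<otimes> t j = s \<otimes> (inv (t j) \<otimes> t j)"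
      using s T.m_comm[of "inv (t j)" s] by (simp add: T.m_assoc)
    then show ?thesis using 1 s by simp
  next
    case 2
    have "inv\<^bsub>B\<^esub> relator \<in> tilde_relations T t"
      unfolding relations_eq by (rule generate.inv) simp
    also have "inv\<^bsub>B\<^esub> relator = (inv (t 2) \<otimes> s \<otimes> t 1 \<otimes> inv s, frag_of 2 - frag_of 1 - (frag_of 1 - frag_of 2))"
      using s by (simp add: relator_def base_inv conjugate_cancel T.inv_mult_group frag_cmul_2 algebra_simps del: mult_2)
    finally show ?thesis using 2 s by (simp add: degree_eq_iff)
  next
    case 3
    have "relator \<in> tilde_relations T t"
      unfolding relations_eq by (rule generate.incl) simp
    also have "relator = (inv (t 1) \<otimes> s \<otimes> t 2 \<otimes> inv s, frag_of 1 - frag_of 2 - (frag_of 2 - frag_of 1))"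
      using s by (simp add: relator_def conjugate_cancel frag_cmul_2 algebra_simps del: mult_2)
    finally show ?thesis using 3 s by (simp add: degree_eq_iff)
  qed
qed

lemma degree_diag: "tilde_degree T t i i s = tilde_degree T t j j s"
  by (simp add: tilde_degree_def)

lemma degree_inj: "s \<in> carrier T \<Longrightarrow> r \<in> carrier T \<Longrightarrow> tilde_degree T t i j s = tilde_degree T t i j r \<Longrightarrow> s = r"
proof -
  assume sr: "s \<in> carrier T" "r \<in> carrier T" and "tilde_degree T t i j s = tilde_degree T t i j r"
  then have "(s \<otimes> inv r, 0) \<in> tilde_relations T t" by (simp add: degree_eq_iff)
  then have "s \<otimes> inv r = \<one>"
  proof (rule in_relations)
    fix n :: int
    assume n: "fst (s \<otimes> inv r, 0 :: 2 \<Rightarrow>\<^sub>0 int) = (inv (t 1) \<otimes> t 2) [^] n"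
      "\<And>i. Poly_Mapping.lookup (snd (s \<otimes> inv r, 0)) i = (if i = 1 then 2 * n else - 2 * n)"
    then show ?thesis using n(2)[of 1] by simp
  qed
  then show "s = r" using sr by (metis T.inv_closed T.inv_inv T.inv_equality)
qed

text \<open>Exponents of the first generator agree modulo 2, which leaves three patterns of indices.
  In each of them the part in \<open>T\<close> is found by \<open>degree_inj\<close>, after
  \<open>degree_diag\<close> or \<open>degree_swap\<close> has made the indices equal.\<close>

lemma degree_eqD:
  assumes sr: "s \<in> carrier T" "r \<in> carrier T" and eq: "tilde_degree T t i j s = tilde_degree T t k l r"
  shows "i = k \<and> j = l \<and> s = r \<or> i = j \<and> k = l \<and> s = r \<or>
    i \<noteq> j \<and> i = l \<and> j = k \<and> s = inv (t l) \<otimes> r \<otimes> t k"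
proof -
  have "(s \<otimes> inv r, frag_of i - frag_of j - (frag_of k - frag_of l)) \<in> tilde_relations T t"
    using eq sr by (simp add: degree_eq_iff)
  then obtain n where n: "Poly_Mapping.lookup (frag_of i - frag_of j - (frag_of k - frag_of l)) 1 = 2 * (n::int)"
    by (rule in_relations) auto
  have "(if i = 1 then 1 else 0) - (if j = 1 then 1 else 0)
      - ((if k = 1 then 1 else 0) - (if l = 1 then 1 else 0)) = 2 * n"
    using n by (simp add: lookup_minus lookup_frag_of)
  then have "even ((if i = 1 then 1 else 0) - (if j = 1 then 1 else 0)
      - ((if k = 1 then 1 else 0) - (if l = 1 then 1 else 0 :: int)))" by simp
  then have "(i = 1) = (k = 1) \<and> (j = 1) = (l = 1) \<or> (i = 1) = (j = 1) \<and> (k = 1) = (l = 1) \<or>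
      (i = 1) \<noteq> (j = 1) \<and> (i = 1) = (l = 1) \<and> (j = 1) = (k = 1)"
    by (auto split: if_splits)
  moreover have "a = b \<longleftrightarrow> (a = 1 \<longleftrightarrow> b = 1)" for a b :: 2
    using exhaust_2[of a] exhaust_2[of b] by auto
  ultimately have "i = k \<and> j = l \<or> i = j \<and> k = l \<or> i \<noteq> j \<and> i = l \<and> j = k"
    by metis
  then consider "i = k" "j = l" | "i = j" "k = l" | "i \<noteq> j" "i = l" "j = k" by blast
  then show ?thesis
  proof cases
    case 1
    then show ?thesis using degree_inj[OF sr] eq by blast
  next
    case 2
    then show ?thesis using degree_inj[OF sr, of i i] degree_diag[of k r i] eq by auto
  next
    case 3
    have "tilde_degree T t i j s = tilde_degree T t i j (inv (t l) \<otimes> r \<otimes> t k)"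
      using eq degree_swap[of r l k] sr 3 by simp
    then show ?thesis using degree_inj[of s "inv (t l) \<otimes> r \<otimes> t k" i j] sr 3 by simp
  qed
qed

lemma tilde_group_comm: "comm_group (tilde_group T t)"
  unfolding tilde_group_def by (rule B.abelian_FactGroup) (rule N.subgroup_axioms)

lemma degree_carrier: "s \<in> carrier T \<Longrightarrow> tilde_degree T t i j s \<in> carrier (tilde_group T t)"
  unfolding tilde_group_def tilde_degree_def carrier_FactGroup by (rule imageI) simp

lemma degree_mult:
  "s \<in> carrier T \<Longrightarrow> r \<in> carrier T \<Longrightarrow>
   tilde_degree T t i j s \<otimes>\<^bsub>tilde_group T t\<^esub> tilde_degree T t j k r = tilde_degree T t i k (s \<otimes> r)"
  by (simp add: tilde_group_def tilde_degree_def N.rcos_sum)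

lemma degree_eq_gen:
  assumes "s \<in> carrier T"
  shows "tilde_gen T t i \<otimes>\<^bsub>tilde_group T t\<^esub> inv\<^bsub>tilde_group T t\<^esub> tilde_gen T t j
    \<otimes>\<^bsub>tilde_group T t\<^esub> tilde_emb T t s = tilde_degree T t i j s"
proof -
  have "tilde_relations T t #>\<^bsub>B\<^esub> (\<one>, frag_of j) \<in> carrier (B Mod tilde_relations T t)"
    unfolding carrier_FactGroup by (rule imageI) simp
  then show ?thesis using assms
    by (simp add: tilde_gen_def tilde_emb_def tilde_group_def tilde_degree_def N.inv_FactGroup N.rcos_inv
        N.rcos_sum base_inv)
qed

end


section \<open>The grading of \<open>M\<^sub>2(D)\<close>\<close>

lemma matrix2_mult: "((A :: 'a::semiring_1^2^2) ** B) $ i $ j = A $ i $ 1 * B $ 1 $ j + A $ i $ 2 * B $ 2 $ j"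
  by (simp add: matrix_matrix_mult_def sum_2)

lemma m2_elem_nth: "m2_elem i j x $ k $ l = (if k = i \<and> l = j then x else 0)"
  by (simp add: m2_elem_def)

lemma m2_elem_mult: "m2_elem i j x ** m2_elem k l y = (if j = k then m2_elem i l (x * y) else (0 :: 'a::semiring_1^2^2))"
  using exhaust_2[of j] exhaust_2[of k]
  by (auto simp: vec_eq_iff matrix2_mult m2_elem_nth)

lemma m2_elem_eq_0_iff [simp]: "m2_elem i j x = 0 \<longleftrightarrow> x = 0"
  by (auto simp: vec_eq_iff m2_elem_nth)

lemma m2_elem_sandwich: "m2_elem k k 1 ** X ** m2_elem l l 1 = m2_elem k l ((X :: 'a::semiring_1^2^2) $ k $ l)"
  using exhaust_2[of k] exhaust_2[of l]
  by (auto simp: vec_eq_iff matrix2_mult m2_elem_nth)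

lemma m2_scale_elem:
  assumes "smul c 0 = 0" shows "m2_scale smul c (m2_elem i j x) = m2_elem i j (smul c x)"
  using assms by (simp add: m2_scale_def m2_elem_def vec_eq_iff)

locale m2_graded_involution = graded_division_involution smul \<phi>\<^sub>0 G \<Gamma>
  for smul :: "'f::field \<Rightarrow> 'd::ring_1 \<Rightarrow> 'd" and \<phi>\<^sub>0 :: "'d \<Rightarrow> 'd"
    and G :: "('g, 'z) monoid_scheme" and \<Gamma> :: "'g \<Rightarrow> 'd set" +
  fixes \<delta> :: 'f and d :: "'d^2"
  assumes central_simple: central_simple
    and \<delta>: "\<delta> \<in> {1, -1}"
    and d_homogeneous: "d $ i \<in> nonzero_homogeneous G \<Gamma>"
    and d_symmetric: "\<phi>\<^sub>0 (d $ i) = smul \<delta> (d $ i)"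
begin

section \<open>The entries of the diagonal matrix and conjugation by them\<close>

definition t :: "2 \<Rightarrow> 'g" where "t i = hom_degree G \<Gamma> (d $ i)"

definition d_inv :: "2 \<Rightarrow> 'd" where
  "d_inv i = (SOME y. y \<in> \<Gamma> (inv\<^bsub>G\<^esub> t i) \<and> d $ i * y = 1 \<and> y * d $ i = 1)"

lemma d: "t i \<in> T" "d $ i \<in> \<Gamma> (t i)" "d $ i \<noteq> 0"
proof -
  obtain g where "g \<in> carrier G" "d $ i \<in> \<Gamma> g" "d $ i \<noteq> 0"
    using d_homogeneous[of i] by (auto simp: nonzero_homogeneous_def)
  then show "t i \<in> T" "d $ i \<in> \<Gamma> (t i)" "d $ i \<noteq> 0" using hom_degree_eq in_T by (auto simp: t_def)
qed

lemma d_inv: "d_inv i \<in> \<Gamma> (inv\<^bsub>G\<^esub> t i)" "d $ i * d_inv i = 1" "d_inv i * d $ i = 1"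
proof -
  have "\<exists>y. y \<in> \<Gamma> (inv\<^bsub>G\<^esub> t i) \<and> d $ i * y = 1 \<and> y * d $ i = 1"
    using inverse(2)[OF T_carrier[OF d(1)] d(2,3)] by blast
  from someI_ex[OF this] show "d_inv i \<in> \<Gamma> (inv\<^bsub>G\<^esub> t i)" "d $ i * d_inv i = 1" "d_inv i * d $ i = 1"
    by (auto simp: d_inv_def)
qed

lemma t_carrier: "t i \<in> carrier G" "inv\<^bsub>G\<^esub> t i \<in> carrier G"
  using T_carrier[OF d(1)] by auto

lemma d_cancel: "d $ i * (d_inv i * x) = x" "d_inv i * (d $ i * x) = x"
  using d_inv by (simp_all add: mult.assoc[symmetric])

lemma \<delta>_square: "\<delta> * \<delta> = 1"
  using \<delta> by auto

lemma \<phi>\<^sub>0_d_inv: "\<phi>\<^sub>0 (d_inv i) = smul \<delta> (d_inv i)"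
proof -
  have "\<phi>\<^sub>0 (d_inv i) * \<phi>\<^sub>0 (d $ i) = \<phi>\<^sub>0 (d $ i * d_inv i)" by (simp only: inv_mul)
  then have "\<phi>\<^sub>0 (d_inv i) * \<phi>\<^sub>0 (d $ i) = 1" by (simp only: d_inv \<phi>\<^sub>0_one)
  moreover have "\<phi>\<^sub>0 (d $ i) * smul \<delta> (d_inv i) = 1"
    using \<delta>_square by (simp add: d_inv d_symmetric mul_scale_left mul_scale_right)
  ultimately show ?thesis by (metis mult.assoc mult_1 mult_1_right)
qed

lemma conjugate_mem: "s \<in> carrier G \<Longrightarrow> x \<in> \<Gamma> s \<Longrightarrow> d_inv j * x * d $ i \<in> \<Gamma> (inv\<^bsub>G\<^esub> t j \<otimes>\<^bsub>G\<^esub> s \<otimes>\<^bsub>G\<^esub> t i)"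
  using grading_mul[OF grading _ _ grading_mul[OF grading _ _ d_inv(1)] d(2)] t_carrier by simp

lemma conjugate_nonzero: "x \<noteq> 0 \<Longrightarrow> d_inv j * x * d $ i \<noteq> 0"
proof
  assume "x \<noteq> 0" "d_inv j * x * d $ i = 0"
  moreover have "x = d $ j * (d_inv j * x * d $ i) * d_inv i"
    using d_inv by (simp add: mult.assoc d_cancel)
  ultimately show False by simp
qed

text \<open>The grading group is abelian, so \<open>x * d $ i\<close> and \<open>d $ i * x\<close>
  lie in the same line and differ by a scalar \<epsilon>. The involution exchanges the two products
  up to the common factor \<delta>\<eta>, which forces \<epsilon> to square to 1.\<close>

lemma conjugate_sign:
  assumes x: "s \<in> carrier G" "x \<in> \<Gamma> s" "x \<noteq> 0"
  obtains \<epsilon> where "\<epsilon> \<in> {1, -1}" "d_inv i * x * d $ i = smul \<epsilon> x"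
proof -
  have "x * d $ i \<in> \<Gamma> (s \<otimes>\<^bsub>G\<^esub> t i)" "d $ i * x \<in> \<Gamma> (s \<otimes>\<^bsub>G\<^esub> t i)"
    using grading_mul[OF grading x(1) t_carrier(1) x(2) d(2)]
      grading_mul[OF grading t_carrier(1) x(1) d(2) x(2)] by (simp_all add: G.m_comm t_carrier x)
  moreover have "d $ i * x \<noteq> 0" by (rule mult_nonzero[OF t_carrier(1) d(2,3) x(3)])
  ultimately obtain \<epsilon> where \<epsilon>: "x * d $ i = smul \<epsilon> (d $ i * x)"
    using component_line[of "s \<otimes>\<^bsub>G\<^esub> t i" "d $ i * x" "x * d $ i"] x t_carrier by auto
  obtain \<eta> where \<eta>: "\<phi>\<^sub>0 x = smul \<eta> x" "\<eta> * \<eta> = 1" by (rule \<phi>\<^sub>0_sign[OF x(1,2)])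
  have "\<phi>\<^sub>0 (x * d $ i) = \<phi>\<^sub>0 (smul \<epsilon> (d $ i * x))" by (simp only: \<epsilon>)
  then have "smul (\<delta> * \<eta>) (d $ i * x) = smul (\<epsilon> * (\<delta> * \<eta>)) (x * d $ i)"
    by (simp add: inv_mul inv_scale d_symmetric \<eta> mul_scale_left mul_scale_right mult_ac)
  then have "smul (\<delta> * \<eta> * (\<delta> * \<eta>)) (d $ i * x) = smul (\<delta> * \<eta> * (\<delta> * \<eta>)) (smul (\<epsilon> * \<epsilon>) (d $ i * x))"
    unfolding \<epsilon> by (simp add: mult_ac)
  moreover have "\<delta> * \<eta> * (\<delta> * \<eta>) = 1" using \<delta>_square \<eta>(2) by (metis mult.assoc mult.commute mult_1_right)
  ultimately have "smul (\<epsilon> * \<epsilon>) (d $ i * x) = d $ i * x" by simp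
  then have "\<epsilon> * \<epsilon> = 1" by (rule scale_left_cancel_unit[OF \<open>d $ i * x \<noteq> 0\<close>])
  then have "\<epsilon> \<in> {1, -1}" by (simp add: square_eq_1_iff)
  moreover have "d_inv i * x * d $ i = smul \<epsilon> x"
    by (simp add: mult.assoc \<epsilon> mul_scale_right d_cancel)
  ultimately show ?thesis using that by blast
qed

text \<open>Otherwise \<open>d\<^sub>2 d\<^sub>1\<inverse>\<close> would be central and hence symmetric, that is, a scalar.\<close>

lemma conjugate_distinct:
  assumes ne: "t 1 \<noteq> t 2"
  obtains s where "s \<in> T" "d_inv 1 * bas s * d $ 1 \<noteq> d_inv 2 * bas s * d $ 2"
proof -
  have False if eq: "\<And>s. s \<in> T \<Longrightarrow> d_inv 1 * bas s * d $ 1 = d_inv 2 * bas s * d $ 2"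
  proof -
  let ?c = "d $ 2 * d_inv 1"
  have "?c * bas s = bas s * ?c" if "s \<in> T" for s
  proof -
    have "?c * bas s = d $ 2 * (d_inv 1 * bas s * d $ 1) * d_inv 1" by (simp add: mult.assoc d_inv)
    also have "\<dots> = bas s * ?c" unfolding eq[OF that] by (simp add: mult.assoc d_cancel)
    finally show ?thesis .
  qed
  then have comm: "?c * (\<Sum>s\<in>T. smul (coef s x) (bas s)) = (\<Sum>s\<in>T. smul (coef s x) (bas s)) * ?c" for x
    by (simp add: mul_sum_left mul_sum_right mul_scale_left mul_scale_right)
  have comm: "?c * x = x * ?c" for x using comm[of x] by (simp only: coef_expand)
  \<comment> \<open>The two factors \<delta> cancel. The result is the conjugate of
    \<open>?c\<close> by \<open>d $ 1\<close>, hence \<open>?c\<close> itself because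
    \<open>?c\<close> commutes with everything.\<close>
  have "\<phi>\<^sub>0 ?c = d_inv 1 * d $ 2"
    using \<delta>_square by (simp add: inv_mul \<phi>\<^sub>0_d_inv d_symmetric mul_scale_left mul_scale_right)
  also have "\<dots> = d_inv 1 * (?c * d $ 1)" by (simp add: mult.assoc d_inv)
  also have "\<dots> = ?c" unfolding comm by (simp add: mult.assoc[symmetric] d_inv)
  finally have "?c \<in> {z \<in> center. \<phi>\<^sub>0 z = z}" using comm by (simp add: center_def)
  then obtain r where "?c = smul r 1" using central_simple unfolding central_simple_def by blast
  then have "?c * d $ 1 = smul r 1 * d $ 1" by simp
  then have "d $ 2 = smul r (d $ 1)" by (simp add: mult.assoc d_inv mul_scale_left)
  then have "d $ 2 \<in> \<Gamma> (t 1)" using d(2)[of 1] grading_subspace[OF grading t_carrier(1)] by (simp add: subspace_scale)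
  then have "t 1 = t 2" by (rule component_disjoint[OF grading t_carrier(1) t_carrier(1) _ d(2) d(3)])
  then show False using ne by simp
  qed
  then show ?thesis using that by blast
qed

abbreviation "TG \<equiv> G\<lparr>carrier := T\<rparr>"

lemma TG_group: "comm_group TG"
  using subgroup.subgroup_is_group[OF T_subgroup G.is_group]
  by (intro group.group_comm_groupI) (auto simp: T_carrier G.m_comm)

sublocale Q: tilde TG t
  using TG_group d(1) by (simp add: tilde_def tilde_axioms_def)

abbreviation "K \<equiv> tilde_group TG t"
abbreviation "dg \<equiv> tilde_degree TG t"

lemma inv_TG: "s \<in> T \<Longrightarrow> inv\<^bsub>TG\<^esub> s = inv\<^bsub>G\<^esub> s"
  by (rule G.m_inv_consistent[OF T_subgroup])

abbreviation "\<phi> \<equiv> m2_involution \<phi>\<^sub>0 d"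

lemma \<phi>_nth: "\<phi> X $ i $ j = d_inv i * \<phi>\<^sub>0 (X $ j $ i) * d $ j"
proof -
  let ?E = "m2_diag (\<chi> i. d_inv i)"
  have E: "m2_diag d ** ?E = mat 1" "?E ** m2_diag d = mat 1"
    by (auto simp: vec_eq_iff forall_2 matrix2_mult m2_diag_def mat_def d_inv)
  \<comment> \<open>\<open>matrix_inv\<close> is defined by choice; uniqueness of two-sided inverses
    determines the chosen matrix.\<close>
  have "matrix_inv (m2_diag d) = ?E"
    unfolding matrix_inv_def
  proof (rule some_equality)
    fix A assume "m2_diag d ** A = mat 1 \<and> A ** m2_diag d = mat 1"
    then show "A = ?E" using E by (metis matrix_mul_assoc matrix_mul_lid matrix_mul_rid)
  qed (use E in auto)
  then show ?thesis using exhaust_2[of i] exhaust_2[of j]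
    by (auto simp: m2_involution_def matrix2_mult m2_diag_def transpose_def)
qed

sublocale M: involution_algebra "m2_scale smul" "(**)" "mat 1" \<phi>
proof unfold_locales
  show "\<phi> (X ** Y) = \<phi> Y ** \<phi> X" for X Y
  proof -
    have "d_inv i * \<phi>\<^sub>0 y * d $ k * (d_inv k * \<phi>\<^sub>0 x * d $ j) = d_inv i * \<phi>\<^sub>0 (x * y) * d $ j" for i j k x y
      by (simp add: mult.assoc d_cancel inv_mul)
    then show ?thesis by (simp add: vec_eq_iff \<phi>_nth matrix2_mult inv_add distrib_left distrib_right)
  qed
  show "\<phi> (\<phi> X) = X" for X
  proof -
    have "d_inv i * \<phi>\<^sub>0 (d_inv j * \<phi>\<^sub>0 x * d $ i) * d $ j = x" for i j x
      using \<delta>_square by (simp add: inv_mul inv_inv d_symmetric \<phi>\<^sub>0_d_inv mul_scale_left mul_scale_right mult.assoc d_cancel d_inv)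
    then show ?thesis by (simp add: vec_eq_iff \<phi>_nth)
  qed
qed (simp_all add: vec_eq_iff m2_scale_def matrix2_mult \<phi>_nth scale_right_distrib scale_left_distrib
    mul_scale_left mul_scale_right distrib_left distrib_right mult.assoc inv_add inv_scale add_ac
    matrix_mul_assoc[symmetric])

lemma scale_elem: "m2_scale smul c (m2_elem i j x) = m2_elem i j (smul c x)"
  by (rule m2_scale_elem) simp

abbreviation V :: "('g \<times> (2 \<Rightarrow>\<^sub>0 int)) set \<Rightarrow> ('d^2^2) set" where "V \<equiv> m2_grading smul G \<Gamma> d"

section \<open>Coordinates of the matrix algebra and its grading\<close>

definition mindex :: "(2 \<times> 2 \<times> 'g) set" where "mindex = UNIV \<times> UNIV \<times> T"
definition mbas :: "2 \<times> 2 \<times> 'g \<Rightarrow> 'd^2^2" where "mbas = (\<lambda>(i, j, s). m2_elem i j (bas s))"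
definition mcoef :: "2 \<times> 2 \<times> 'g \<Rightarrow> 'd^2^2 \<Rightarrow> 'f" where "mcoef = (\<lambda>(i, j, s) X. coef s (X $ i $ j))"
definition mdeg where "mdeg = (\<lambda>(i, j, s). dg i j s)"

lemmas m_defs = mindex_def mbas_def mcoef_def mdeg_def

lemma finite_mindex: "finite mindex"
  unfolding mindex_def by (intro finite_cartesian_product finite_T) auto

lemma mcoef_add: "mcoef p (X + Y) = mcoef p X + mcoef p Y"
  by (cases p) (simp add: mcoef_def coef_add)

lemma mcoef_scale: "mcoef p (m2_scale smul r X) = r * mcoef p X"
  by (cases p) (simp add: mcoef_def coef_scale m2_scale_def)

lemma mcoef_expand: "(\<Sum>p\<in>mindex. m2_scale smul (mcoef p X) (mbas p)) = X"
proof -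
  have "(\<Sum>s\<in>T. m2_elem i j (f s)) = m2_elem i j (\<Sum>s\<in>T. f s)" for i j T and f :: "'g \<Rightarrow> 'd"
    by (induction T rule: infinite_finite_induct) (simp_all add: vec_eq_iff m2_elem_nth)
  then have elem: "(\<Sum>s\<in>T. m2_scale smul (mcoef (i, j, s) X) (mbas (i, j, s))) = m2_elem i j (X $ i $ j)" for i j
    by (simp add: mcoef_def mbas_def scale_elem coef_expand)
  have "(\<Sum>p\<in>mindex. m2_scale smul (mcoef p X) (mbas p)) =
      (\<Sum>i\<in>UNIV. \<Sum>j\<in>UNIV. \<Sum>s\<in>T. m2_scale smul (mcoef (i, j, s) X) (mbas (i, j, s)))"
    by (simp only: mindex_def sum.cartesian_product case_prod_unfold prod.collapse)
  also have "\<dots> = (\<Sum>i\<in>UNIV. \<Sum>j\<in>UNIV. m2_elem i j (X $ i $ j))" by (simp only: elem)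
  also have "\<dots> = X" by (simp add: vec_eq_iff sum_2 m2_elem_nth forall_2)
  finally show ?thesis .
qed

lemma elem_mdeg:
  assumes "s \<in> T" "x \<in> \<Gamma> s" "p \<in> mindex" "mcoef p (m2_elem i j x) \<noteq> 0"
  shows "mdeg p = dg i j s"
proof -
  obtain k l r where p: "p = (k, l, r)" "r \<in> T" using assms(3) by (auto simp: mindex_def)
  then have "k = i" "l = j" "coef r x \<noteq> 0"
    using assms(4) by (auto simp: mcoef_def m2_elem_nth split: if_splits)
  then have "r = s" using coef_nonzero[of x s r] assms(1,2) p T_carrier by simp
  then show ?thesis by (simp add: mdeg_def p \<open>k = i\<close> \<open>l = j\<close>)
qed

text \<open>Passing from spans to coordinate conditions makes \<open>grading_of_coordinates\<close>
  applicable. Each coordinate that may be nonzero belongs to a basis element that is itself among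
  the spanning elements.\<close>

lemma V_eq: "V = (\<lambda>\<gamma>. {X. \<forall>p\<in>mindex. mcoef p X \<noteq> 0 \<longrightarrow> mdeg p = \<gamma>})"
proof
  fix \<gamma>
  let ?C = "{X. \<forall>p\<in>mindex. mcoef p X \<noteq> 0 \<longrightarrow> mdeg p = \<gamma>}"
  let ?S = "{m2_elem i j x | i j s x. s \<in> T \<and> x \<in> \<Gamma> s \<and> dg i j s = \<gamma>}"
  have mcoef0: "mcoef p 0 = 0" for p using mcoef_scale[of p 0 0] by simp
  have "V \<gamma> = M.span {m2_elem i j x | i j s x. s \<in> T \<and> x \<in> \<Gamma> s \<and>
      tilde_gen TG t i \<otimes>\<^bsub>K\<^esub> inv\<^bsub>K\<^esub> tilde_gen TG t j \<otimes>\<^bsub>K\<^esub> tilde_emb TG t s = \<gamma>}"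
    unfolding m2_grading_def Let_def t_def[abs_def, symmetric] by simp
  also have "{m2_elem i j x | i j s x. s \<in> T \<and> x \<in> \<Gamma> s \<and>
      tilde_gen TG t i \<otimes>\<^bsub>K\<^esub> inv\<^bsub>K\<^esub> tilde_gen TG t j \<otimes>\<^bsub>K\<^esub> tilde_emb TG t s = \<gamma>} = ?S"
    by (intro Collect_cong ex_cong1 conj_cong refl) (simp add: Q.degree_eq_gen)
  also have "M.span ?S = ?C"
  proof
    have "M.subspace ?C"
      unfolding M.subspace_def by (auto simp: mcoef0 mcoef_add mcoef_scale)
    moreover have "?S \<subseteq> ?C"
      using elem_mdeg by blast
    ultimately show "M.span ?S \<subseteq> ?C" by (intro M.span_minimal)
    show "?C \<subseteq> M.span ?S"
    proof
      fix X assume X: "X \<in> ?C"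
      have "m2_scale smul (mcoef p X) (mbas p) \<in> M.span ?S" if p: "p \<in> mindex" for p
      proof (cases "mcoef p X = 0")
        case False
        then have "mdeg p = \<gamma>" using X p by blast
        moreover obtain i j s where "p = (i, j, s)" "s \<in> T" using p by (auto simp: mindex_def)
        moreover have "m2_elem i j (bas s) \<in> ?S" if "s \<in> T" "dg i j s = \<gamma>"
          using that bas(1) by blast
        ultimately have "mbas p \<in> ?S" by (simp add: mbas_def mdeg_def)
        then show ?thesis by (intro M.span_scale M.span_base)
      qed (simp add: M.span_zero)
      then have "(\<Sum>p\<in>mindex. m2_scale smul (mcoef p X) (mbas p)) \<in> M.span ?S" by (intro M.span_sum)
      then show "X \<in> M.span ?S" by (simp only: mcoef_expand)
    qed
  qed
  finally show "V \<gamma> = ?C" .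
qed

text \<open>On basis elements, compatibility with products is \<open>degree_mult\<close> and
  compatibility with the involution is \<open>degree_swap\<close>.\<close>

lemma V_inv_grading: "M.is_inv_grading K V"
  unfolding V_eq
proof (rule M.inv_grading_of_coordinates[where b = mbas])
  show "M.is_grading K (\<lambda>\<gamma>. {X. \<forall>p\<in>mindex. mcoef p X \<noteq> 0 \<longrightarrow> mdeg p = \<gamma>})"
  proof (rule M.grading_of_coordinates[where b = mbas])
    show "mcoef p (mbas q) = (if p = q then 1 else 0)" if "p \<in> mindex" "q \<in> mindex" for p q
      using that by (cases p; cases q) (auto simp: m_defs m2_elem_nth coef_bas)
    show "mdeg p \<in> carrier K" if "p \<in> mindex" for p
      using that Q.degree_carrier by (cases p) (auto simp: m_defs)
    show "mdeg r = mdeg p \<otimes>\<^bsub>K\<^esub> mdeg q"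
      if "p \<in> mindex" "q \<in> mindex" "r \<in> mindex" and nz: "mcoef r (mbas p ** mbas q) \<noteq> 0" for p q r
    proof -
      obtain i j s where p: "p = (i, j, s)" "s \<in> T" using \<open>p \<in> mindex\<close> by (auto simp: mindex_def)
      obtain k l u where q: "q = (k, l, u)" "u \<in> T" using \<open>q \<in> mindex\<close> by (auto simp: mindex_def)
      obtain m n v where r: "r = (m, n, v)" "v \<in> T" using \<open>r \<in> mindex\<close> by (auto simp: mindex_def)
      have *: "j = k" "m = i" "n = l" "coef v (bas s * bas u) \<noteq> 0"
        using nz by (auto simp: m_defs p q r m2_elem_mult m2_elem_nth split: if_splits)
      have "bas s * bas u \<in> \<Gamma> (s \<otimes>\<^bsub>G\<^esub> u)" using grading_mul[OF grading] p q bas T_carrier by blast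
      then have "v = s \<otimes>\<^bsub>G\<^esub> u" using coef_nonzero *(4) r p q T_carrier by blast
      then show ?thesis using Q.degree_mult[of s u i j l] p q r * by (simp add: mdeg_def)
    qed
  qed (simp_all add: Q.tilde_group_comm finite_mindex mcoef_add mcoef_scale mcoef_expand)
  show "mdeg r = mdeg p" if "p \<in> mindex" "r \<in> mindex" and nz: "mcoef r (\<phi> (mbas p)) \<noteq> 0" for p r
  proof -
    obtain i j s where p: "p = (i, j, s)" "s \<in> T" using \<open>p \<in> mindex\<close> by (auto simp: mindex_def)
    obtain m n v where r: "r = (m, n, v)" "v \<in> T" using \<open>r \<in> mindex\<close> by (auto simp: mindex_def)
    have *: "m = j" "n = i" "coef v (d_inv j * \<phi>\<^sub>0 (bas s) * d $ i) \<noteq> 0"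
      using nz by (auto simp: m_defs p r \<phi>_nth m2_elem_nth \<phi>\<^sub>0_zero split: if_splits)
    have "d_inv j * \<phi>\<^sub>0 (bas s) * d $ i \<in> \<Gamma> (inv\<^bsub>G\<^esub> t j \<otimes>\<^bsub>G\<^esub> s \<otimes>\<^bsub>G\<^esub> t i)"
      using p by (intro conjugate_mem \<phi>\<^sub>0_mem bas T_carrier)
    then have "v = inv\<^bsub>G\<^esub> t j \<otimes>\<^bsub>G\<^esub> s \<otimes>\<^bsub>G\<^esub> t i"
      using coef_nonzero *(3) r p t_carrier T_carrier by blast
    then show ?thesis using Q.degree_swap[of s j i] p r * by (simp add: mdeg_def inv_TG d)
  qed
qed (simp_all add: mcoef_add mcoef_scale mcoef_expand)

lemma V_grading: "M.is_grading K V"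
  using V_inv_grading by (simp add: M.is_inv_grading_def)

text \<open>Needed for \<open>fine_imp_no_proper_refinement\<close>, which passes from grading
  groups on \<open>nat\<close> to those of any type.\<close>

lemma m2_finite_dim: "M.finite_dim"
  unfolding M.finite_dim_def
proof (intro exI conjI)
  show "finite (mbas ` mindex)" using finite_mindex by simp
  have "(\<Sum>p\<in>mindex. m2_scale smul (mcoef p X) (mbas p)) \<in> M.span (mbas ` mindex)" for X
    by (intro M.span_sum M.span_scale M.span_base imageI)
  then show "M.span (mbas ` mindex) = UNIV" by (auto simp: mcoef_expand)
qed

lemma elem_in_V: "s \<in> T \<Longrightarrow> x \<in> \<Gamma> s \<Longrightarrow> m2_elem i j x \<in> V (dg i j s)"
  unfolding V_eq using elem_mdeg by blast

lemma V_coef: "X \<in> V \<gamma> \<Longrightarrow> s \<in> T \<Longrightarrow> coef s (X $ i $ j) \<noteq> 0 \<Longrightarrow> dg i j s = \<gamma>"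
  unfolding V_eq by (auto simp: m_defs)

lemma V_entry_0:
  assumes "X \<in> V \<gamma>" "\<And>s. s \<in> T \<Longrightarrow> dg i j s \<noteq> \<gamma>"
  shows "X $ i $ j = 0"
proof (rule coef_ext)
  show "coef s (X $ i $ j) = coef s 0" if "s \<in> T" for s
    using V_coef[OF assms(1) that, of i j] assms(2)[OF that] by auto
qed

text \<open>With the position fixed, the degree determines the element of \<open>T\<close> by
  \<open>degree_inj\<close>, so a single coordinate of that entry can be nonzero.\<close>

lemma V_entry:
  assumes X: "X \<in> V (dg i j s)" and s: "s \<in> T" and x: "x \<in> \<Gamma> s" "x \<noteq> 0"
  obtains \<alpha> where "X $ i $ j = smul \<alpha> x"
proof -
  have "X $ i $ j = smul (coef s (X $ i $ j)) (bas s)"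
  proof (rule coef_ext)
    fix r assume r: "r \<in> T"
    have "coef r (X $ i $ j) = 0" if "r \<noteq> s"
      using V_coef[OF X r, of i j] Q.degree_inj[of r s i j] r s that by auto
    then show "coef r (X $ i $ j) = coef r (smul (coef s (X $ i $ j)) (bas s))"
      using r s by (auto simp: coef_scale coef_bas)
  qed
  moreover obtain c where "bas s = smul c x"
    using component_line[OF T_carrier[OF s] x bas(1)[OF s]] by blast
  ultimately have "X $ i $ j = smul (coef s (X $ i $ j) * c) x" by simp
  then show ?thesis by (rule that)
qed

text \<open>By \<open>degree_eqD\<close> a diagonal position never shares its degree with an
  off-diagonal one.\<close>

lemma V_diag_entries:
  assumes X: "X \<in> V (dg 1 1 s)" and s: "s \<in> T" and x: "x \<in> \<Gamma> s" "x \<noteq> 0"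
  obtains \<alpha> \<beta> where "X = m2_elem 1 1 (smul \<alpha> x) + m2_elem 2 2 (smul \<beta> x)"
proof -
  obtain \<alpha> where "X $ 1 $ 1 = smul \<alpha> x" by (rule V_entry[OF X s x])
  moreover obtain \<beta> where "X $ 2 $ 2 = smul \<beta> x"
    using V_entry[of X 2 2 s x] X s x Q.degree_diag[of 1 s 2] by auto
  moreover have "X $ 1 $ 2 = 0" "X $ 2 $ 1 = 0"
    using Q.degree_eqD[of _ s 1 2 1 1] Q.degree_eqD[of _ s 2 1 1 1] s
    by (auto intro!: V_entry_0[OF X])
  ultimately show ?thesis by (intro that[of \<alpha> \<beta>]) (simp add: vec_eq_iff forall_2 m2_elem_nth)
qed

section \<open>Equal degrees: an explicit proper refinement\<close>

lemma equal_degree_proper_refinement: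
  assumes char: "CHAR('f) \<noteq> 2" and eq: "t 1 = t 2"
  shows "\<exists>(H :: (('g \<times> (2 \<Rightarrow>\<^sub>0 int)) set \<times> 'f) monoid) \<Delta>. M.is_inv_grading H \<Delta> \<and> is_proper_refinement H \<Delta> K V"
proof -
  obtain c where c: "d $ 1 = smul c (d $ 2)"
    using component_line[OF t_carrier(1) d(2,3), of "d $ 1" 2] d(2)[of 1] eq by auto
  have c0: "c \<noteq> 0" using c d(3)[of 1] by auto
  have d_inv_1: "d_inv 1 = smul (1 / c) (d_inv 2)"
  proof -
    have "smul (1 / c) (d_inv 2) = d_inv 1 * (d $ 1 * smul (1 / c) (d_inv 2))" by (simp add: d_cancel)
    also have "d $ 1 * smul (1 / c) (d_inv 2) = 1"
      using c0 by (simp add: c mul_scale_left mul_scale_right d_inv)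
    finally show ?thesis by simp
  qed
  \<comment> \<open>Conjugation by \<open>E_12 + c E_21\<close> in entries: \<open>sw\<close> is the
    underlying permutation and \<open>r i\<close> is the nonzero entry of row \<open>i\<close>; the
    inverse matrix contributes the reciprocals.\<close>
  define sw :: "2 \<Rightarrow> 2" where "sw i = (if i = 1 then 2 else 1)" for i
  define r :: "2 \<Rightarrow> 'f" where "r i = (if i = 1 then 1 else c)" for i
  have sw: "sw 1 = 2" "sw 2 = 1" and r: "r 1 = 1" "r 2 = c" by (simp_all add: sw_def r_def)
  define \<psi> :: "'d^2^2 \<Rightarrow> 'd^2^2" where "\<psi> X = (\<chi> i j. smul (r i / r j) (X $ sw i $ sw j))" for X
  have \<psi>: "\<psi> X $ i $ j = smul (r i / r j) (X $ sw i $ sw j)" for X i j by (simp add: \<psi>_def)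
  \<comment> \<open>With equal degrees the conjugation in \<open>degree_swap\<close> is trivial, so
    exchanging the indices leaves the degree unchanged and \<psi> preserves the components.\<close>
  have dsw: "dg (sw i) (sw j) s = dg i j s" if s: "s \<in> T" for i j s
  proof (cases "i = j")
    case True
    then show ?thesis using Q.degree_diag by metis
  next
    case False
    then have "sw i = j" "sw j = i" using exhaust_2[of i] exhaust_2[of j] by (auto simp: sw)
    moreover have "t i = t j" using eq exhaust_2[of i] exhaust_2[of j] by auto
    moreover have "inv\<^bsub>G\<^esub> t j \<otimes>\<^bsub>G\<^esub> s \<otimes>\<^bsub>G\<^esub> t j = s"
    proof -
      have "inv\<^bsub>G\<^esub> t j \<otimes>\<^bsub>G\<^esub> s \<otimes>\<^bsub>G\<^esub> t j = s \<otimes>\<^bsub>G\<^esub> (inv\<^bsub>G\<^esub> t j \<otimes>\<^bsub>G\<^esub> t j)"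
        using t_carrier T_carrier[OF s] by (simp add: G.m_assoc G.m_comm[of "inv\<^bsub>G\<^esub> t j" s])
      then show ?thesis using t_carrier T_carrier[OF s] by simp
    qed
    ultimately show ?thesis using Q.degree_swap[of s j i] s by (simp add: inv_TG d)
  qed
  have ch: "(1::'f) \<noteq> - 1"
  proof
    assume "(1::'f) = - 1"
    then have "of_nat 2 = (0::'f)" by (simp add: eq_neg_iff_add_eq_0)
    then have "CHAR('f) dvd 2" by (simp only: of_nat_eq_0_iff_char_dvd)
    then have "CHAR('f) \<noteq> 0" "CHAR('f) \<le> 2" by (auto intro: dvd_imp_le ccontr)
    then have "CHAR('f) = 1" using char by linarith
    then show False using CHAR_not_1 by auto
  qed
  have invol: "\<psi> (\<psi> X) = X" for X
    using c0 by (simp add: vec_eq_iff forall_2 \<psi> sw r)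
  have mul: "\<psi> (X ** Y) = \<psi> X ** \<psi> Y" for X Y
    using c0 by (simp add: vec_eq_iff forall_2 \<psi> sw r matrix2_mult mul_scale_left mul_scale_right
        scale_right_distrib add.commute)
  \<comment> \<open>The scalars produced by \<psi> match those produced by replacing
    \<open>d $ 1\<close> with its multiple of \<open>d $ 2\<close>.\<close>
  have inv: "\<psi> (\<phi> X) = \<phi> (\<psi> X)" for X
    using c0 by (simp add: vec_eq_iff forall_2 \<psi> sw r \<phi>_nth c d_inv_1 inv_scale mul_scale_left mul_scale_right)
  have pres: "\<psi> X \<in> V \<gamma>" if X: "X \<in> V \<gamma>" for X \<gamma>
  proof -
    have "dg i j s = \<gamma>" if "s \<in> T" "coef s (\<psi> X $ i $ j) \<noteq> 0" for i j s
      using V_coef[OF X that(1), of "sw i" "sw j"] dsw that by (simp add: \<psi> coef_scale)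
    then show ?thesis unfolding V_eq by (auto simp: m_defs)
  qed
  show ?thesis
  proof (rule M.involutive_automorphism_refinement[OF V_inv_grading ch _ _ mul inv invol pres])
    \<comment> \<open>The witness is \<open>E_11\<close>: \<psi> sends it to \<open>E_22\<close>, so
      it is no eigenvector for 1 or -1.\<close>
    show "dg 1 1 \<one>\<^bsub>G\<^esub> \<in> carrier K" using one_T by (intro Q.degree_carrier) simp
    show "m2_elem 1 1 1 \<in> V (dg 1 1 \<one>\<^bsub>G\<^esub>)" by (rule elem_in_V[OF one_T one_mem])
    show "\<psi> (m2_elem 1 1 1) \<noteq> m2_elem 1 1 1" "\<psi> (m2_elem 1 1 1) \<noteq> - m2_elem 1 1 1"
      by (auto simp: vec_eq_iff forall_2 \<psi> sw r m2_elem_nth)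
    show "\<psi> (X + Y) = \<psi> X + \<psi> Y" "\<psi> (m2_scale smul k X) = m2_scale smul k (\<psi> X)" for X Y k
      by (simp_all add: vec_eq_iff forall_2 \<psi> m2_scale_def scale_right_distrib mult.commute)
  qed
qed

section \<open>Distinct degrees: a fixed refinement of the grading\<close>

context
  fixes H :: "('h, 'y) monoid_scheme" and \<Delta> :: "'h \<Rightarrow> ('d^2^2) set"
  assumes H_inv: "M.is_inv_grading H \<Delta>" and H_ref: "is_refinement H \<Delta> K V"
begin

lemma H_grading: "M.is_grading H \<Delta>"
  using H_inv by (simp add: M.is_inv_grading_def)

interpretation H: comm_group H
  using H_grading by (simp add: M.is_grading_def)

lemma H_\<phi>: "h \<in> carrier H \<Longrightarrow> X \<in> \<Delta> h \<Longrightarrow> \<phi> X \<in> \<Delta> h"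
  using H_inv by (auto simp: M.is_inv_grading_def)

lemma H_scale: "h \<in> carrier H \<Longrightarrow> X \<in> \<Delta> h \<Longrightarrow> m2_scale smul c X \<in> \<Delta> h"
  using M.grading_subspace[OF H_grading] by (simp add: M.subspace_scale)

lemma H_elem_scale: "h \<in> carrier H \<Longrightarrow> m2_elem i j x \<in> \<Delta> h \<Longrightarrow> m2_elem i j (smul c x) \<in> \<Delta> h"
  using H_scale[of h "m2_elem i j x" c] by (simp add: scale_elem)

lemma H_unscale: "h \<in> carrier H \<Longrightarrow> m2_scale smul c X \<in> \<Delta> h \<Longrightarrow> c \<noteq> 0 \<Longrightarrow> X \<in> \<Delta> h"
  using H_scale[of h "m2_scale smul c X" "1 / c"] by simp

lemmas H_mult = M.grading_mul[OF H_grading]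
lemmas H_disjoint = M.component_disjoint[OF H_grading]
lemmas H_one = M.unit_homogeneous[OF H_grading]

lemma dg_carrier: "s \<in> T \<Longrightarrow> dg i j s \<in> carrier K"
  by (rule Q.degree_carrier) simp

lemma H_part:
  assumes "x \<in> \<Gamma> s" "s \<in> T" "M.subspace W" "m2_elem i j x \<notin> W"
  obtains h y where "h \<in> carrier H" "y \<in> \<Delta> h" "y \<in> V (dg i j s)" "y \<notin> W"
  using M.refinement_part[OF V_grading H_grading H_ref elem_in_V[OF assms(2,1)] dg_carrier[OF assms(2)] assms(3,4)]
  by blast

text \<open>A homogeneous diagonal \<open>y\<close> with scalar entries \<alpha>, \<beta> and
  non-neutral degree satisfies its characteristic equation. The terms \<open>y\<close> and 1 have
  different degrees while \<open>y ** y\<close> is homogeneous, so \<alpha>\<beta> or \<alpha> +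
  \<beta> vanishes. If only \<alpha>\<beta> vanished, \<open>y ** y\<close> would be a nonzero
  multiple of \<open>y\<close>, making its degree neutral. So the trace is zero.\<close>

lemma diag_difference_homogeneous:
  assumes nonneutral: "m2_elem 1 1 1 \<notin> \<Delta> \<one>\<^bsub>H\<^esub>"
  obtains h where "h \<in> carrier H" "h \<noteq> \<one>\<^bsub>H\<^esub>" "m2_elem 1 1 1 - m2_elem 2 2 1 \<in> \<Delta> h"
proof -
  \<comment> \<open>The subspace to be avoided is the neutral component of \<Delta>, so the part
    \<open>y\<close> of \<open>E_11\<close> has another degree.\<close>
  obtain h y where h: "h \<in> carrier H" and y: "y \<in> \<Delta> h" "y \<in> V (dg 1 1 \<one>\<^bsub>G\<^esub>)" and ny: "y \<notin> \<Delta> \<one>\<^bsub>H\<^esub>"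
    using H_part[OF one_mem one_T M.grading_subspace[OF H_grading H.one_closed] nonneutral] by blast
  have h1: "h \<noteq> \<one>\<^bsub>H\<^esub>" using y ny by auto
  have y0: "y \<noteq> 0" using ny M.subspace_0[OF M.grading_subspace[OF H_grading H.one_closed]] by auto
  obtain \<alpha> \<beta> where yd: "y = m2_elem 1 1 (smul \<alpha> 1) + m2_elem 2 2 (smul \<beta> 1)"
    by (rule V_diag_entries[OF y(2) one_T one_mem]) auto
  have sq: "y ** y = m2_scale smul (- (\<alpha> * \<beta>)) (mat 1) + m2_scale smul (\<alpha> + \<beta>) y"
  proof -
    have "smul x 1 * smul x 1 = smul (- (\<alpha> * \<beta>)) 1 + smul (\<alpha> + \<beta>) (smul x 1)" if "x = \<alpha> \<or> x = \<beta>" for x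
    proof -
      have "x * x = - (\<alpha> * \<beta>) + (\<alpha> + \<beta>) * x" using that by (auto simp: algebra_simps)
      then show ?thesis
        by (simp only: mul_scale_left mul_scale_right scale_scale mult_1_left scale_left_distrib[symmetric])
    qed
    from this[of \<alpha>] this[of \<beta>] show ?thesis
      by (simp add: yd vec_eq_iff forall_2 matrix2_mult m2_elem_nth m2_scale_def mat_def)
  qed
  have hh: "h \<otimes>\<^bsub>H\<^esub> h \<in> carrier H" using h by simp
  have yy: "y ** y \<in> \<Delta> (h \<otimes>\<^bsub>H\<^esub> h)" by (rule H_mult[OF h h y(1) y(1)])
  have "m2_scale smul (- (\<alpha> * \<beta>)) (mat 1) = 0 \<or> m2_scale smul (\<alpha> + \<beta>) y = 0"
    using M.homogeneous_add_cases[OF H_grading hh H.one_closed h yy[unfolded sq]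
        H_scale[OF H.one_closed H_one] H_scale[OF h y(1)]] h1 by blast
  moreover have "\<alpha> * \<beta> \<noteq> 0 \<or> \<alpha> + \<beta> = 0"
  proof (rule ccontr)
    assume *: "\<not> ?thesis"
    then have "y ** y = m2_scale smul (\<alpha> + \<beta>) y" using sq by simp
    then have "y \<in> \<Delta> (h \<otimes>\<^bsub>H\<^esub> h)" using yy * H_unscale[OF hh, of "\<alpha> + \<beta>" y] by simp
    then have "h \<otimes>\<^bsub>H\<^esub> h = h" using H_disjoint[OF hh h _ y(1) y0] by simp
    then show False using h h1 by simp
  qed
  moreover have "(mat 1 :: 'd^2^2) \<noteq> 0" by (simp add: vec_eq_iff forall_2 mat_def)
  ultimately have "\<beta> = - \<alpha>" using y0 by (auto simp: eq_neg_iff_add_eq_0 add.commute)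
  then have ya: "y = m2_scale smul \<alpha> (m2_elem 1 1 1 - m2_elem 2 2 1)"
    by (simp add: yd vec_eq_iff forall_2 m2_elem_nth m2_scale_def)
  moreover have "\<alpha> \<noteq> 0" using y0 ya by auto
  ultimately have "m2_elem 1 1 1 - m2_elem 2 2 1 \<in> \<Delta> h" using H_unscale[OF h] y(1) by blast
  then show ?thesis using that h h1 by blast
qed

lemma diag_neutral:
  assumes ne: "t 1 \<noteq> t 2"
  shows "m2_elem i i 1 \<in> \<Delta> \<one>\<^bsub>H\<^esub>"
proof -
  have E1: "m2_elem 1 1 1 \<in> \<Delta> \<one>\<^bsub>H\<^esub>"
  proof (rule ccontr)
    let ?a = "m2_elem 1 1 1 - m2_elem 2 2 1 :: 'd^2^2"
    assume "m2_elem 1 1 1 \<notin> \<Delta> \<one>\<^bsub>H\<^esub>"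
    then obtain h where h: "h \<in> carrier H" "h \<noteq> \<one>\<^bsub>H\<^esub>" "?a \<in> \<Delta> h"
      by (rule diag_difference_homogeneous)
    obtain s where s: "s \<in> T" "d_inv 1 * bas s * d $ 1 \<noteq> d_inv 2 * bas s * d $ 2"
      by (rule conjugate_distinct[OF ne])
    let ?x = "bas s"
    note x = bas[OF s(1)]
    \<comment> \<open>Avoiding the zero subspace only asks for a nonzero homogeneous
      \<open>z\<close>.\<close>
    obtain m z where m: "m \<in> carrier H" "z \<in> \<Delta> m" "z \<in> V (dg 1 1 s)" "z \<noteq> 0"
      using H_part[OF x(1) s(1) M.subspace_single_0, of 1 1] x by auto
    obtain p q where z: "z = m2_elem 1 1 (smul p ?x) + m2_elem 2 2 (smul q ?x)"
      by (rule V_diag_entries[OF m(3) s(1) x])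
    obtain \<eta> where \<eta>: "\<phi>\<^sub>0 ?x = smul \<eta> ?x" "\<eta> * \<eta> = 1" by (rule \<phi>\<^sub>0_sign[OF T_carrier[OF s(1)] x(1)])
    obtain \<epsilon>1 where 1: "\<epsilon>1 \<in> {1, -1}" "d_inv 1 * ?x * d $ 1 = smul \<epsilon>1 ?x"
      by (rule conjugate_sign[OF T_carrier[OF s(1)] x])
    obtain \<epsilon>2 where 2: "\<epsilon>2 \<in> {1, -1}" "d_inv 2 * ?x * d $ 2 = smul \<epsilon>2 ?x"
      by (rule conjugate_sign[OF T_carrier[OF s(1)] x])
    have 12: "\<epsilon>2 = - \<epsilon>1" "\<epsilon>1 \<noteq> 0" using 1 2 s(2) by auto
    have az: "?a ** z = m2_elem 1 1 (smul p ?x) - m2_elem 2 2 (smul q ?x)"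
      by (simp add: z vec_eq_iff forall_2 matrix2_mult m2_elem_nth)
    have az0: "?a ** z \<noteq> 0" using m(4) by (simp only: az) (simp add: z vec_eq_iff forall_2 m2_elem_nth)
    \<comment> \<open>The involution scales the two diagonal entries of \<open>z\<close> by \<eta>
      times opposite signs, which is what left multiplication by \<open>?a\<close> does up to a
      scalar.\<close>
    have "\<phi> z = m2_scale smul (\<eta> * \<epsilon>1) (?a ** z)"
      unfolding az by (simp add: z vec_eq_iff forall_2 m2_elem_nth m2_scale_def \<phi>_nth \<phi>\<^sub>0_zero inv_scale \<eta>
          mul_scale_left mul_scale_right 1(2)[unfolded mult.assoc] 2(2)[unfolded mult.assoc] 12 mult_ac)
    then have "m2_scale smul (\<eta> * \<epsilon>1) (?a ** z) \<in> \<Delta> m" using H_\<phi>[OF m(1,2)] by simp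
    then have "?a ** z \<in> \<Delta> m" using H_unscale[OF m(1)] \<eta>(2) 12(2) by (metis mult_eq_0_iff zero_neq_one)
    moreover have "?a ** z \<in> \<Delta> (h \<otimes>\<^bsub>H\<^esub> m)" by (rule H_mult[OF h(1) m(1) h(3) m(2)])
    \<comment> \<open>The nonzero element \<open>?a ** z\<close> has degree \<open>m\<close> through
      the involution and degree \<open>h\<close> times \<open>m\<close> through the product.\<close>
    ultimately have "m = h \<otimes>\<^bsub>H\<^esub> m" using H_disjoint[OF m(1) _ _ _ az0, of "h \<otimes>\<^bsub>H\<^esub> m"] h m by simp
    then show False using h m by simp
  qed
  have "mat 1 - m2_elem 1 1 1 \<in> \<Delta> \<one>\<^bsub>H\<^esub>"
    by (intro M.subspace_diff M.grading_subspace[OF H_grading] H_one E1) simp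
  also have "mat 1 - m2_elem 1 1 1 = (m2_elem 2 2 1 :: 'd^2^2)"
    by (simp add: vec_eq_iff forall_2 mat_def m2_elem_nth)
  finally show ?thesis using E1 exhaust_2[of i] by auto
qed

text \<open>Multiplying by the diagonal idempotents on both sides isolates an entry, and it does not
  change the degree because they are neutral.\<close>

lemma sandwich_homogeneous:
  assumes ne: "t 1 \<noteq> t 2" and h: "h \<in> carrier H" and X: "X \<in> \<Delta> h"
  shows "m2_elem k l (X $ k $ l) \<in> \<Delta> h"
proof -
  have "m2_elem k k 1 ** X ** m2_elem l l 1 \<in> \<Delta> (\<one>\<^bsub>H\<^esub> \<otimes>\<^bsub>H\<^esub> h \<otimes>\<^bsub>H\<^esub> \<one>\<^bsub>H\<^esub>)"
    using h X by (intro H_mult diag_neutral[OF ne]) auto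
  then show ?thesis using h by (simp add: m2_elem_sandwich)
qed

text \<open>Avoiding the matrices whose \<open>(i, j)\<close> entry vanishes gives a homogeneous
  element with nonzero scalar in that position. It may have other entries too, which the sandwich
  removes.\<close>

lemma unit_homogeneous_degree:
  assumes ne: "t 1 \<noteq> t 2"
  obtains k where "k \<in> carrier H" "m2_elem i j 1 \<in> \<Delta> k"
proof -
  let ?W = "{X :: 'd^2^2. X $ i $ j = 0}"
  have "M.subspace ?W" unfolding M.subspace_def by (auto simp: m2_scale_def)
  moreover have "m2_elem i j 1 \<notin> ?W" by (simp add: m2_elem_nth)
  ultimately obtain k y where k: "k \<in> carrier H" "y \<in> \<Delta> k" "y \<in> V (dg i j \<one>\<^bsub>G\<^esub>)" "y \<notin> ?W"
    by (rule H_part[OF one_mem one_T])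
  obtain \<alpha> where \<alpha>: "y $ i $ j = smul \<alpha> 1" by (rule V_entry[OF k(3) one_T one_mem]) auto
  have "m2_scale smul \<alpha> (m2_elem i j 1) \<in> \<Delta> k"
    using sandwich_homogeneous[OF ne k(1,2), of i j] by (simp add: \<alpha> scale_elem)
  moreover have "\<alpha> \<noteq> 0" using k(4) \<alpha> by auto
  ultimately show ?thesis using that k(1) H_unscale by blast
qed

text \<open>A nonzero entry of a homogeneous \<open>z\<close> yields one basis element in
  \<open>\<Delta> h\<close>. By \<open>degree_eqD\<close> any other basis element of the same degree
  is either its diagonal partner, reached with matrix units, or its transposed partner, reached with
  the involution; so \<open>\<Delta> h\<close> is the whole component.\<close>

lemma not_proper_refinement:
  assumes ne: "t 1 \<noteq> t 2"
  shows "\<not> is_proper_refinement H \<Delta> K V"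
proof
  assume "is_proper_refinement H \<Delta> K V"
  then obtain h \<gamma> where h: "h \<in> carrier H" "\<Delta> h \<noteq> {0}" "\<Delta> h \<subset> V \<gamma>"
    unfolding is_proper_refinement_def by blast
  note sub = M.grading_subspace[OF H_grading h(1)]
  obtain z where z: "z \<in> \<Delta> h" "z \<noteq> 0" using h M.subspace_0[OF sub] by blast
  have "\<exists>k l r. r \<in> T \<and> coef r (z $ k $ l) \<noteq> 0"
  proof (rule ccontr)
    assume "\<not> ?thesis"
    then have "z $ k $ l = 0" for k l by (intro coef_ext) auto
    then show False using z by (simp add: vec_eq_iff)
  qed
  then obtain k l r where r: "r \<in> T" "coef r (z $ k $ l) \<noteq> 0" by blast
  have zV: "z \<in> V \<gamma>" using z h by blast
  have klr: "dg k l r = \<gamma>" by (rule V_coef[OF zV r])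
  obtain \<alpha> where \<alpha>: "z $ k $ l = smul \<alpha> (bas r)"
    by (rule V_entry[OF _ r(1) bas[OF r(1)], of z k l]) (use zV klr in auto)
  have "m2_scale smul \<alpha> (m2_elem k l (bas r)) \<in> \<Delta> h"
    using sandwich_homogeneous[OF ne h(1) z(1), of k l] by (simp add: \<alpha> scale_elem)
  moreover have "\<alpha> \<noteq> 0" using r(2) \<alpha> by auto
  ultimately have kl: "m2_elem k l (bas r) \<in> \<Delta> h" using H_unscale h(1) by blast
  have elem: "m2_elem i j (bas s) \<in> \<Delta> h" if s: "s \<in> T" and ijs: "dg i j s = \<gamma>" for i j s
  proof -
    consider "i = k" "j = l" "s = r" | "i = j" "k = l" "s = r"
      | "i = l" "j = k" "s = inv\<^bsub>G\<^esub> t l \<otimes>\<^bsub>G\<^esub> r \<otimes>\<^bsub>G\<^esub> t k"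
      using Q.degree_eqD[of s r i j k l] s r ijs klr by (auto simp: inv_TG d)
    then show ?thesis
    proof cases
      case 1
      then show ?thesis using kl by simp
    next
      case 2
      obtain p where p: "p \<in> carrier H" "m2_elem i k 1 \<in> \<Delta> p" by (rule unit_homogeneous_degree[OF ne])
      obtain q where q: "q \<in> carrier H" "m2_elem k i 1 \<in> \<Delta> q" by (rule unit_homogeneous_degree[OF ne])
      have "m2_elem i k 1 ** m2_elem k i 1 \<in> \<Delta> (p \<otimes>\<^bsub>H\<^esub> q)" by (rule H_mult[OF p(1) q(1) p(2) q(2)])
      then have "m2_elem i i 1 \<in> \<Delta> (p \<otimes>\<^bsub>H\<^esub> q)" by (simp add: m2_elem_mult)
      \<comment> \<open>The matrix units \<open>E_ik\<close> and \<open>E_ki\<close> have inverse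
        degrees, as their product is neutral; conjugation with them therefore stays in degree
        \<open>h\<close>.\<close>
      then have pq: "p \<otimes>\<^bsub>H\<^esub> q = \<one>\<^bsub>H\<^esub>"
        using H_disjoint[OF _ H.one_closed _ diag_neutral[OF ne, of i]] p q by simp
      have "m2_elem i k 1 ** m2_elem k k (bas r) ** m2_elem k i 1 \<in> \<Delta> (p \<otimes>\<^bsub>H\<^esub> h \<otimes>\<^bsub>H\<^esub> q)"
        using p q h kl 2 by (intro H_mult) auto
      moreover have "p \<otimes>\<^bsub>H\<^esub> h \<otimes>\<^bsub>H\<^esub> q = h \<otimes>\<^bsub>H\<^esub> (p \<otimes>\<^bsub>H\<^esub> q)"
        using p q h by (simp add: H.m_ac)
      ultimately show ?thesis using 2 h by (simp add: m2_elem_mult pq)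
    next
      case 3
      let ?x = "d_inv l * \<phi>\<^sub>0 (bas r) * d $ k"
      have "\<phi> (m2_elem k l (bas r)) = m2_elem l k ?x"
        by (simp add: vec_eq_iff \<phi>_nth m2_elem_nth \<phi>\<^sub>0_zero)
      then have "m2_elem l k ?x \<in> \<Delta> h" using H_\<phi>[OF h(1) kl] by simp
      moreover have "?x \<in> \<Gamma> s"
        unfolding 3 using r by (intro conjugate_mem \<phi>\<^sub>0_mem bas T_carrier)
      moreover have "\<phi>\<^sub>0 (bas r) \<noteq> 0" using bas(2)[OF r(1)] \<phi>\<^sub>0_zero inv_inv by metis
      then have "?x \<noteq> 0" by (rule conjugate_nonzero)
      \<comment> \<open>The image under the involution is nonzero in a one-dimensional component, so
        it spans the line of \<open>bas s\<close>.\<close>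
      ultimately obtain c where "bas s = smul c ?x"
        using component_line[OF T_carrier[OF s]] bas(1)[OF s] by blast
      then show ?thesis using H_elem_scale[OF h(1) \<open>m2_elem l k ?x \<in> \<Delta> h\<close>] 3 by simp
    qed
  qed
  have "V \<gamma> \<subseteq> \<Delta> h"
  proof
    fix X assume X: "X \<in> V \<gamma>"
    have "m2_scale smul (mcoef p X) (mbas p) \<in> \<Delta> h" if p: "p \<in> mindex" for p
    proof (cases "mcoef p X = 0")
      case False
      moreover obtain i j s where p: "p = (i, j, s)" "s \<in> T" using p by (auto simp: mindex_def)
      ultimately have "mbas p \<in> \<Delta> h" using V_coef[OF X] elem by (auto simp: mcoef_def mbas_def)
      then show ?thesis by (rule H_scale[OF h(1)])
    qed (simp add: M.subspace_0[OF sub])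
    then have "(\<Sum>p\<in>mindex. m2_scale smul (mcoef p X) (mbas p)) \<in> \<Delta> h" by (intro M.subspace_sum[OF sub])
    then show "X \<in> \<Delta> h" by (simp only: mcoef_expand)
  qed
  then show False using h by blast
qed

end

theorem fine_iff:
  assumes "CHAR('f) \<noteq> 2"
  shows "M.is_fine K V \<longleftrightarrow> t 1 \<noteq> t 2"
proof
  assume fine: "M.is_fine K V"
  show "t 1 \<noteq> t 2"
    using equal_degree_proper_refinement[OF assms] M.fine_imp_no_proper_refinement[OF m2_finite_dim fine] by blast
next
  assume ne: "t 1 \<noteq> t 2"
  have "\<not> (M.is_inv_grading H \<Delta> \<and> is_proper_refinement H \<Delta> K V)" for H :: "nat monoid" and \<Delta>
    using not_proper_refinement[of H \<Delta>, OF _ _ ne] unfolding is_proper_refinement_def by blast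
  then show "M.is_fine K V"
    unfolding M.is_fine_def using V_inv_grading by blast
qed

end


theorem proposition4p8:
  fixes smul :: "'f::field \<Rightarrow> 'd::ring_1 \<Rightarrow> 'd"
    and \<phi>\<^sub>0 :: "'d \<Rightarrow> 'd"
    and G :: "('g, 'z) monoid_scheme"
    and \<Gamma> :: "'g \<Rightarrow> 'd set"
    and \<delta> :: 'f
    and d :: "'d^2"
  assumes char_not_2: "CHAR('f) \<noteq> 2"
    and "involution_algebra smul (*) 1 \<phi>\<^sub>0"
    and "unital_algebra.finite_dim smul"
    and "unital_algebra.is_division_grading smul (*) 1 G \<Gamma>"
    and "unital_algebra.one_dim_components smul G \<Gamma>"
    and "involution_algebra.is_inv_grading smul (*) \<phi>\<^sub>0 G \<Gamma>"
    and "involution_algebra.central_simple smul (*) 1 \<phi>\<^sub>0"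
    and "\<delta> \<in> {1, -1}"
    and "\<And>i. d $ i \<in> nonzero_homogeneous G \<Gamma>"
    and "\<And>i. \<phi>\<^sub>0 (d $ i) = smul \<delta> (d $ i)"
  shows "involution_algebra.is_fine (m2_scale smul) (**) (m2_involution \<phi>\<^sub>0 d)
           (m2_group G \<Gamma> d) (m2_grading smul G \<Gamma> d)
         \<longleftrightarrow> hom_degree G \<Gamma> (d $ 1) \<noteq> hom_degree G \<Gamma> (d $ 2)"
proof -
  interpret D: involution_algebra smul "(*)" 1 \<phi>\<^sub>0 by fact
  interpret m2_graded_involution smul \<phi>\<^sub>0 G \<Gamma> \<delta> d
    by unfold_locales (use assms in auto)
  have "m2_group G \<Gamma> d = K" by (simp add: m2_group_def t_def[abs_def])
  then show ?thesis using fine_iff[OF char_not_2] by (simp add: t_def)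
qed


end
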